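(* Let $\mathfrak{H}$ be a complex separable Hilbert space of infinite dimension. Suppose that $T$ is a bounded self-adjoint operator on $\mathfrak{H}$, that $S=\langle\cdot,\varphi\rangle\varphi$ is a self-adjoint operator of rank one on $\mathfrak{H}$, and that the vector $\varphi$ is cyclic for $T$. For $\lambda\in\mathbb{R}$ put $D(\lambda)=E_{(-\infty,\lambda)}(T+S)-E_{(-\infty,\lambda)}(T)$. Let $\lambda\in\mathbb{R}\setminus\{\min\sigma_{\mathrm{ess}}(T),\max\sigma_{\mathrm{ess}}(T)\}$. Then the kernel of $D(\lambda)$ is (1) infinite dimensional if and only if $\lambda\in\mathbb{R}\setminus[\min\sigma_{\mathrm{ess}}(T),\max\sigma_{\mathrm{ess}}(T)]$; (2) trivial if and only if $\lambda\in(\min\sigma_{\mathrm{ess}}(T),\max\sigma_{\mathrm{ess}}(T))$. In particular, either $\mathrm{Ker}\,D(\lambda)=\{0\}$ or $\dim\mathrm{Ker}\,D(\lambda)=\infty$.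
   Context: $E_\Omega(X)$ denotes the spectral projection of a self-adjoint operator $X$ associated with the Borel set $\Omega\subset\mathbb{R}$, and $\sigma_{\mathrm{ess}}(X)$ its essential spectrum. A vector $x\in\mathfrak{H}$ is called cyclic for $T$ if the closed linear span of $\{E_\Omega(T)x:\Omega\subset\mathbb{R}\text{ Borel}\}$ equals $\mathfrak{H}$. *)

theory Defs
  imports "HOL-Analysis.Analysis"
begin

class complex_vector = real_vector +
  fixes scaleC :: "complex \<Rightarrow> 'a \<Rightarrow> 'a"  (infixr \<open>*\<^sub>C\<close> 75)
  assumes scaleC_add_right: "a *\<^sub>C (x + y) = a *\<^sub>C x + a *\<^sub>C y"
    and scaleC_add_left: "(a + b) *\<^sub>C x = a *\<^sub>C x + b *\<^sub>C x"
    and scaleC_scaleC: "a *\<^sub>C b *\<^sub>C x = (a * b) *\<^sub>C x"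
    and scaleC_one: "1 *\<^sub>C x = x"
    and scaleR_scaleC: "r *\<^sub>R x = complex_of_real r *\<^sub>C x"

(* The complex inner product is linear in the first argument; its real part is the
   real inner product, so that norm, metric and topology are those of real_inner. *)
class complex_inner = complex_vector + real_inner +
  fixes cinner :: "'a \<Rightarrow> 'a \<Rightarrow> complex"
  assumes cinner_commute: "cinner x y = cnj (cinner y x)"
    and cinner_add_left: "cinner (x + y) z = cinner x z + cinner y z"
    and cinner_scaleC_left: "cinner (c *\<^sub>C x) y = c * cinner x y"
    and Re_cinner: "Re (cinner x y) = inner x y"

class complex_hilbert_space = complex_inner + complete_space

global_interpretation complex_vector:
  vector_space "scaleC :: complex \<Rightarrow> 'a \<Rightarrow> 'a::complex_vector"
  defines cspan_raw_def: cspan = complex_vector.span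
    and cdim_raw_def: cdim = complex_vector.dim
  by unfold_locales
    (simp_all add: scaleC_add_right scaleC_add_left scaleC_scaleC scaleC_one)

(* cdim is 0 for spaces without a finite basis as well as for the zero space,
   hence a separate predicate. *)
definition infinite_cdim :: "'a::complex_vector set \<Rightarrow> bool" where
  "infinite_cdim V \<longleftrightarrow> \<not> (\<exists>B. finite B \<and> V \<subseteq> cspan B)"

definition bounded_clinear :: "('a::complex_inner \<Rightarrow> 'a) \<Rightarrow> bool" where
  "bounded_clinear T \<longleftrightarrow> bounded_linear T \<and> (\<forall>c x. T (c *\<^sub>C x) = c *\<^sub>C T x)"

definition selfadjoint :: "('a::complex_inner \<Rightarrow> 'a) \<Rightarrow> bool" where
  "selfadjoint T \<longleftrightarrow> bounded_clinear T \<and> (\<forall>x y. cinner (T x) y = cinner x (T y))"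

definition orth_projection :: "('a::complex_inner \<Rightarrow> 'a) \<Rightarrow> bool" where
  "orth_projection P \<longleftrightarrow> selfadjoint P \<and> P \<circ> P = P"

definition op_kernel :: "('a::complex_inner \<Rightarrow> 'a) \<Rightarrow> 'a set" where
  "op_kernel T = {x. T x = 0}"

definition spectrum :: "('a::complex_inner \<Rightarrow> 'a) \<Rightarrow> complex set" where
  "spectrum T = {z. \<not> (\<exists>R. bounded_clinear R \<and>
     (\<forall>x. R (T x - z *\<^sub>C x) = x) \<and> (\<forall>x. T (R x) - z *\<^sub>C R x = x))}"

(* The essential spectrum of a self-adjoint operator: the spectrum without the isolated
   eigenvalues of finite multiplicity. It is taken as a subset of the reals, as the spectrum
   of a self-adjoint operator is real. *)
definition discrete_spectrum :: "('a::complex_inner \<Rightarrow> 'a) \<Rightarrow> real set" where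
  "discrete_spectrum T = {l. complex_of_real l isolated_in spectrum T \<and>
     op_kernel (\<lambda>x. T x - complex_of_real l *\<^sub>C x) \<noteq> {0} \<and>
     \<not> infinite_cdim (op_kernel (\<lambda>x. T x - complex_of_real l *\<^sub>C x))}"

definition ess_spectrum :: "('a::complex_inner \<Rightarrow> 'a) \<Rightarrow> real set" where
  "ess_spectrum T = {l. complex_of_real l \<in> spectrum T} - discrete_spectrum T"

(* The library's Min and Max are meant for finite sets only. *)
definition min_ess :: "('a::complex_inner \<Rightarrow> 'a) \<Rightarrow> real" where
  "min_ess T = (LEAST l. l \<in> ess_spectrum T)"

definition max_ess :: "('a::complex_inner \<Rightarrow> 'a) \<Rightarrow> real" where
  "max_ess T = (GREATEST l. l \<in> ess_spectrum T)"

definition projection_valued_measure :: "(real set \<Rightarrow> 'a::complex_inner \<Rightarrow> 'a) \<Rightarrow> bool" where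
  "projection_valued_measure E \<longleftrightarrow>
     (\<forall>\<Omega> \<in> sets borel. orth_projection (E \<Omega>)) \<and>
     E UNIV = id \<and>
     (\<forall>A :: nat \<Rightarrow> real set. range A \<subseteq> sets borel \<longrightarrow> disjoint_family A \<longrightarrow>
        (\<forall>x. (\<lambda>n. E (A n) x) sums E (\<Union>n. A n) x))"

definition scalar_measure :: "(real set \<Rightarrow> 'a::complex_inner \<Rightarrow> 'a) \<Rightarrow> 'a \<Rightarrow> real measure" where
  "scalar_measure E x = measure_of UNIV (sets borel) (\<lambda>\<Omega>. ennreal (Re (cinner (E \<Omega> x) x)))"

(* T is the integral of t dE(t), in the weak sense; by polarization the diagonal
   matrix elements suffice. *)
definition is_spectral_measure ::
    "(real set \<Rightarrow> 'a::complex_inner \<Rightarrow> 'a) \<Rightarrow> ('a \<Rightarrow> 'a) \<Rightarrow> bool" where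
  "is_spectral_measure E T \<longleftrightarrow> projection_valued_measure E \<and>
     (\<forall>x. has_bochner_integral (scalar_measure E x) complex_of_real (cinner (T x) x))"

(* For bounded self-adjoint T the spectral theorem provides such an E, and its values on
   Borel sets are unique; values on other sets are irrelevant. *)
definition spectral_projection :: "('a::complex_inner \<Rightarrow> 'a) \<Rightarrow> real set \<Rightarrow> 'a \<Rightarrow> 'a" where
  "spectral_projection T = (SOME E. is_spectral_measure E T)"

definition cyclic_vector :: "('a::complex_inner \<Rightarrow> 'a) \<Rightarrow> 'a \<Rightarrow> bool" where
  "cyclic_vector T x \<longleftrightarrow>
     closure (cspan ((\<lambda>\<Omega>. spectral_projection T \<Omega> x) ` sets borel)) = UNIV"

end

theory Submission
  imports Defs "HOL-Probability.Helly_Selection" "HOL-Real_Asymp.Real_Asymp"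
begin

text \<open>Write P and Q for the projections of T and T' = T + S belonging to the half-line below l.
  Then Ker (Q - P) is the sum of the intersection of the two ranges and the intersection of the
  two kernels. If l lies outside the convex hull of the essential spectrum of T, then P and Q are
  both of finite rank or both of finite corank, so the kernel is infinite dimensional.

  If s > l is in the essential spectrum and x is in both ranges, then u = (T - t)^-1 x and
  v = (T' - t)^-1 x exist and are bounded for t near s, and (T - t) (u - v) = a(t) \<phi> where
  a(t) is the inner product of v and \<phi>. If a vanishes to infinite order at s, then the cyclicity
  of \<phi> forces x = 0. Otherwise a has no zeros in a punctured neighbourhood of s, so that \<phi> has
  locally bounded preimages under T - t there, which makes the spectral measure vanish; then s is
  at most an isolated simple eigenvalue, a contradiction. The kernels are treated in the same way
  with s < l.

  The existence of the spectral measure is derived from the Hausdorff moment problem: for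
  0 \<le> A \<le> 1 the numbers inner (A^j (1 - A)^i x) x are a completely monotone array.\<close>

section \<open>Complex inner product spaces\<close>

instance complex_hilbert_space \<subseteq> banach ..

lemma scaleC_zero_left [simp]: "0 *\<^sub>C (x::'a::complex_vector) = 0"
  by (metis of_real_0 scaleR_scaleC scale_zero_left)

lemma scaleC_zero_right [simp]: "c *\<^sub>C (0::'a::complex_vector) = 0"
  by (metis add_cancel_right_right scaleC_add_right)

lemma scaleC_minus_right: "c *\<^sub>C (- x) = - (c *\<^sub>C (x::'a::complex_vector))"
  by (metis add_eq_0_iff scaleC_add_right scaleC_zero_right)

lemma scaleC_diff_right: "c *\<^sub>C (x - y) = c *\<^sub>C x - c *\<^sub>C (y::'a::complex_vector)"
  by (metis (no_types) add_uminus_conv_diff scaleC_add_right scaleC_minus_right)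

lemma scaleC_of_real [simp]: "complex_of_real r *\<^sub>C x = r *\<^sub>R (x::'a::complex_vector)"
  by (rule scaleR_scaleC[symmetric])

lemma scaleC_scaleR: "c *\<^sub>C (r *\<^sub>R x) = r *\<^sub>R (c *\<^sub>C (x::'a::complex_vector))"
  by (simp add: scaleR_scaleC scaleC_scaleC mult.commute del: scaleC_of_real)

lemma cinner_add_right: "cinner x (y + z) = cinner x y + cinner x (z::'a::complex_inner)"
  by (metis cinner_add_left cinner_commute complex_cnj_add)

lemma cinner_scaleC_right: "cinner x (c *\<^sub>C y) = cnj c * cinner x (y::'a::complex_inner)"
  by (metis cinner_commute cinner_scaleC_left complex_cnj_mult)

lemma cinner_zero_left [simp]: "cinner 0 (y::'a::complex_inner) = 0"
  by (metis cinner_scaleC_left mult_zero_left scaleC_zero_left)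

lemma cinner_zero_right [simp]: "cinner y (0::'a::complex_inner) = 0"
  by (metis cinner_commute cinner_zero_left complex_cnj_zero)

lemma cinner_diff_left: "cinner (x - y) z = cinner x z - cinner y (z::'a::complex_inner)"
  by (metis cinner_add_left diff_add_cancel eq_diff_eq)

lemma cinner_diff_right: "cinner z (x - y) = cinner z x - cinner z (y::'a::complex_inner)"
  by (metis cinner_add_right diff_add_cancel eq_diff_eq)

lemma cinner_scaleR_left: "cinner (r *\<^sub>R x) y = complex_of_real r * cinner x (y::'a::complex_inner)"
  by (simp add: scaleR_scaleC cinner_scaleC_left del: scaleC_of_real)

lemma Im_cinner: "Im (cinner x y) = inner x (\<i> *\<^sub>C (y::'a::complex_inner))"
  by (simp add: Re_cinner[symmetric] cinner_scaleC_right)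

lemma cinner_eq_inner:
  "cinner x y = Complex (inner x y) (inner x (\<i> *\<^sub>C (y::'a::complex_inner)))"
  by (simp add: complex_eq_iff Re_cinner Im_cinner)

lemma cinner_self: "cinner x x = complex_of_real ((norm (x::'a::complex_inner))\<^sup>2)"
proof -
  have "Im (cinner x x) = 0"
    by (metis Im_complex_of_real Reals_cnj_iff Reals_cases cinner_commute)
  then show ?thesis
    by (simp add: complex_eq_iff Re_cinner power2_norm_eq_inner)
qed

lemma norm_scaleC: "norm (c *\<^sub>C x) = cmod c * norm (x::'a::complex_inner)"
proof -
  have "complex_of_real ((norm (c *\<^sub>C x))\<^sup>2) = complex_of_real ((cmod c * norm x)\<^sup>2)"
    using complex_norm_square[of c]
    by (simp add: cinner_self[symmetric] cinner_scaleC_left cinner_scaleC_right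
        power_mult_distrib of_real_mult del: of_real_power)
  then have "(norm (c *\<^sub>C x))\<^sup>2 = (cmod c * norm x)\<^sup>2"
    using of_real_eq_iff by blast
  then show ?thesis by simp
qed

lemma cmod_cinner_le: "cmod (cinner x y) \<le> norm x * norm (y::'a::complex_inner)"
proof (cases "cinner x y = 0")
  case False
  define u where "u = cnj (cinner x y) / cmod (cinner x y)"
  have u: "cmod u = 1" using False by (simp add: u_def norm_divide)
  have "cinner (u *\<^sub>C x) y = cmod (cinner x y)"
    using False complex_norm_square[of "cinner x y"]
    by (simp add: u_def cinner_scaleC_left field_simps power2_eq_square)
  then have "cmod (cinner x y) = inner (u *\<^sub>C x) y"
    by (metis Re_cinner Re_complex_of_real)
  also have "\<dots> \<le> norm (u *\<^sub>C x) * norm y" by (rule norm_cauchy_schwarz)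
  finally show ?thesis by (simp add: norm_scaleC u)
qed simp

lemma bounded_linear_cinner_left: "bounded_linear (\<lambda>x. cinner x (y::'a::complex_inner))"
  by (rule bounded_linear_intro[where K = "norm y"])
    (auto simp: cinner_add_left cinner_scaleR_left scaleR_conv_of_real cmod_cinner_le)

lemma bounded_linear_scaleC: "bounded_linear (\<lambda>x. c *\<^sub>C (x::'a::complex_inner))"
  by (rule bounded_linear_intro[where K = "cmod c"])
    (auto simp: scaleC_add_right scaleC_scaleR norm_scaleC mult.commute)

lemma inner_scaleC_ii: "inner (\<i> *\<^sub>C x) (\<i> *\<^sub>C y) = inner x (y::'a::complex_inner)"
  by (simp add: Re_cinner[symmetric] cinner_scaleC_left cinner_scaleC_right)

lemma cinner_0_iff: "cinner x y = 0 \<longleftrightarrow> cinner y (x::'a::complex_inner) = 0"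
  by (metis cinner_commute complex_cnj_zero)

section \<open>Bounded self-adjoint operators\<close>

lemma bounded_clinearD:
  assumes "bounded_clinear T"
  shows "bounded_linear T" "T (x + y) = T x + T y" "T (x - y) = T x - T y" "T 0 = 0" "T (- x) = - T x"
    "T (c *\<^sub>C x) = c *\<^sub>C T x" "T (r *\<^sub>R x) = r *\<^sub>R T x"
proof -
  interpret bounded_linear T using assms by (simp add: bounded_clinear_def)
  show "bounded_linear T" by unfold_locales
  show "T (x + y) = T x + T y" "T (x - y) = T x - T y" "T 0 = 0" "T (- x) = - T x"  "T (r *\<^sub>R x) = r *\<^sub>R T x"
    by (auto simp: add diff neg scaleR)
  show "T (c *\<^sub>C x) = c *\<^sub>C T x" using assms by (simp add: bounded_clinear_def)
qed

lemma bounded_clinear_bound: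
  assumes "bounded_clinear T" obtains K where "K > 0" "\<And>x. norm (T x) \<le> K * norm x"
  using bounded_linear.pos_bounded[OF bounded_clinearD(1)[OF assms]] by (metis mult.commute)

lemma selfadjointD:
  assumes "selfadjoint T"
  shows "bounded_clinear T" "cinner (T x) y = cinner x (T y)" "inner (T x) y = inner x (T y)"
  using assms by (auto simp: selfadjoint_def Re_cinner[symmetric])

lemmas selfadjoint_simps = bounded_clinearD(2-7)[OF selfadjointD(1)]

lemma selfadjointI:
  assumes "bounded_clinear T" "\<And>x y. inner (T x) y = inner x (T y)"
  shows "selfadjoint T"
  unfolding selfadjoint_def cinner_eq_inner
  using assms bounded_clinearD(6)[OF assms(1), of \<i>] by (metis (no_types))

lemma selfadjoint_cinner_self:
  assumes "selfadjoint T" shows "cinner (T x) x = complex_of_real (inner (T x) x)"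
proof -
  have "cinner (T x) x = cnj (cinner (T x) x)"
    by (metis assms cinner_commute selfadjointD(2))
  then have "Im (cinner (T x) x) = 0" by (simp add: complex_eq_iff)
  then show ?thesis by (simp add: complex_eq_iff Re_cinner)
qed

lemma bounded_clinear_id: "bounded_clinear (\<lambda>x. x)"
  by (simp add: bounded_clinear_def bounded_linear_ident)

lemma bounded_clinear_scaleR:
  "bounded_clinear A \<Longrightarrow> bounded_clinear (\<lambda>x. r *\<^sub>R A x)"
  by (auto simp: bounded_clinear_def scaleC_scaleR bounded_linear_const_scaleR)

lemma bounded_clinear_add:
  "bounded_clinear A \<Longrightarrow> bounded_clinear B \<Longrightarrow> bounded_clinear (\<lambda>x. A x + B x)"
  by (auto simp: bounded_clinear_def scaleC_add_right bounded_linear_add)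

lemma bounded_clinear_diff:
  "bounded_clinear A \<Longrightarrow> bounded_clinear B \<Longrightarrow> bounded_clinear (\<lambda>x. A x - B x)"
  by (auto simp: bounded_clinear_def scaleC_diff_right bounded_linear_sub)

lemma bounded_clinear_compose:
  "bounded_clinear A \<Longrightarrow> bounded_clinear B \<Longrightarrow> bounded_clinear (\<lambda>x. A (B x))"
  by (auto simp: bounded_clinear_def bounded_linear_compose)

lemma bounded_clinear_scaleC: "bounded_clinear (\<lambda>x. c *\<^sub>C x)"
  by (simp add: bounded_clinear_def bounded_linear_scaleC scaleC_scaleC mult.commute)

lemma selfadjoint_id: "selfadjoint (\<lambda>x. x)"
  by (simp add: selfadjoint_def bounded_clinear_id)

lemma selfadjoint_scaleR: "selfadjoint A \<Longrightarrow> selfadjoint (\<lambda>x. r *\<^sub>R A x)"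
  using selfadjointD(1,3)[of A] by (intro selfadjointI bounded_clinear_scaleR) auto

lemma selfadjoint_add: "selfadjoint A \<Longrightarrow> selfadjoint B \<Longrightarrow> selfadjoint (\<lambda>x. A x + B x)"
  using selfadjointD(1,3)[of A] selfadjointD(1,3)[of B]
  by (intro selfadjointI bounded_clinear_add) (auto simp: inner_add)

lemma selfadjoint_diff: "selfadjoint A \<Longrightarrow> selfadjoint B \<Longrightarrow> selfadjoint (\<lambda>x. A x - B x)"
  using selfadjointD(1,3)[of A] selfadjointD(1,3)[of B]
  by (intro selfadjointI bounded_clinear_diff) (auto simp: inner_diff)

lemma selfadjoint_shift: "selfadjoint A \<Longrightarrow> selfadjoint (\<lambda>x. A x - s *\<^sub>R x)"
  by (intro selfadjoint_diff selfadjoint_scaleR selfadjoint_id)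

lemma selfadjoint_compose:
  assumes "selfadjoint A" "selfadjoint B" "\<And>x. A (B x) = B (A x)"
  shows "selfadjoint (\<lambda>x. A (B x))"
proof (rule selfadjointI)
  show "bounded_clinear (\<lambda>x. A (B x))"
    by (rule bounded_clinear_compose[OF selfadjointD(1)[OF assms(1)] selfadjointD(1)[OF assms(2)]])
  show "inner (A (B x)) y = inner x (A (B y))" for x y
    by (simp only: selfadjointD(3)[OF assms(1)] selfadjointD(3)[OF assms(2)] assms(3))
qed

lemma selfadjoint_form_zero:
  assumes N: "selfadjoint N" and "\<And>x. inner (N x) x = 0"
  shows "N x = 0"
proof -
  have "0 = inner (N (x + N x)) (x + N x) - inner (N (N x)) (N x) - inner (N x) x"
    using assms(2) by simp
  also have "\<dots> = 2 * inner (N x) (N x)"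
    by (simp add: selfadjoint_simps[OF N] inner_add selfadjointD(3)[OF N, of "N x" x])
  finally show ?thesis by simp
qed

lemma selfadjoint_form_bound:
  assumes N: "selfadjoint N" and k: "k \<ge> 0"
    and V: "\<And>x y. x \<in> V \<Longrightarrow> y \<in> V \<Longrightarrow> x + y \<in> V" "\<And>r x. x \<in> V \<Longrightarrow> r *\<^sub>R x \<in> V" "\<And>x. x \<in> V \<Longrightarrow> N x \<in> V"
    and b: "\<And>x. x \<in> V \<Longrightarrow> \<bar>inner (N x) x\<bar> \<le> k * (norm x)\<^sup>2" and x: "x \<in> V"
  shows "norm (N x) \<le> k * norm x"
proof (cases "N x = 0 \<or> x = 0")
  case True then show ?thesis using k selfadjoint_simps[OF N] by auto
next
  case False
  define w where "w = (norm x / norm (N x)) *\<^sub>R N x"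
  have w: "w \<in> V" "norm w = norm x" using V x False by (auto simp: w_def)
  have m: "x - w \<in> V" using V(1)[OF x V(2)[OF w(1), of "-1"]] by simp
  have "4 * inner (N x) w = inner (N (x + w)) (x + w) - inner (N (x - w)) (x - w)"
    by (simp add: selfadjoint_simps[OF N] inner_add inner_diff inner_commute[of w "N x"] selfadjointD(3)[OF N, of w x])
  also have "\<dots> \<le> k * (norm (x + w))\<^sup>2 + k * (norm (x - w))\<^sup>2"
    using b[OF V(1)[OF x w(1)]] b[OF m] by linarith
  also have "\<dots> = k * (2 * (norm x)\<^sup>2 + 2 * (norm w)\<^sup>2)"
    by (simp add: power2_norm_eq_inner inner_add inner_diff inner_commute algebra_simps)
  finally have "inner (N x) w \<le> k * (norm x)\<^sup>2" by (simp add: w(2))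
  moreover have "inner (N x) w = norm x * norm (N x)"
    using False by (simp add: w_def power2_norm_eq_inner[symmetric] power2_eq_square)
  ultimately show ?thesis using False by (simp add: power2_eq_square)
qed

section \<open>Orthogonal projections\<close>

lemma orth_projectionD:
  assumes "orth_projection P"
  shows "selfadjoint P" "P (P x) = P x" "inner (P x) x = (norm (P x))\<^sup>2" "inner (P x) (y - P y) = 0"
    "cinner (P x) (y - P y) = 0"
proof -
  show 1: "selfadjoint P" and 2: "P (P x) = P x" for x
    using assms unfolding orth_projection_def by (auto simp: o_def fun_eq_iff)
  show "inner (P x) x = (norm (P x))\<^sup>2"
    by (metis 2 selfadjointD(3)[OF 1] power2_norm_eq_inner)
  show "inner (P x) (y - P y) = 0"
    by (simp add: selfadjointD(3)[OF 1] selfadjoint_simps[OF 1] 2)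
  show "cinner (P x) (y - P y) = 0"
    by (simp add: selfadjointD(2)[OF 1] selfadjoint_simps[OF 1] 2)
qed

lemma orth_projectionI:
  assumes "selfadjoint P" "\<And>x. P (P x) = P x" shows "orth_projection P"
  using assms by (auto simp: orth_projection_def)

lemma orth_projection_norm:
  assumes "orth_projection P"
  shows "(norm x)\<^sup>2 = (norm (P x))\<^sup>2 + (norm (x - P x))\<^sup>2"
proof -
  have "(norm (P x + (x - P x)))\<^sup>2 = (norm (P x))\<^sup>2 + (norm (x - P x))\<^sup>2"
    using norm_add_Pythagorean[of "P x" "x - P x"] orth_projectionD(4)[OF assms]
    by (simp add: orthogonal_def)
  then show ?thesis by simp
qed

lemma orth_projection_norm_le:
  assumes "orth_projection P" shows "norm (P x) \<le> norm x"
proof (rule power2_le_imp_le)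
  show "(norm (P x))\<^sup>2 \<le> (norm x)\<^sup>2"
    using orth_projection_norm[OF assms, of x] zero_le_power2[of "norm (x - P x)"] by linarith
qed simp

lemma orth_projection_complement:
  assumes "orth_projection P" shows "orth_projection (\<lambda>x. x - P x)"
  by (rule orth_projectionI[OF selfadjoint_diff[OF selfadjoint_id orth_projectionD(1)[OF assms]]])
    (simp add: orth_projectionD(2)[OF assms] selfadjoint_simps(2)[OF orth_projectionD(1)[OF assms]])

lemma orth_projection_eqI:
  assumes "orth_projection P" "orth_projection Q" "\<And>x. inner (P x) x = inner (Q x) x"
  shows "P = Q"
proof (rule ext)
  fix x
  have "P x - Q x = 0"
    by (rule selfadjoint_form_zero[OF selfadjoint_diff[OF orth_projectionD(1)[OF assms(1)] orth_projectionD(1)[OF assms(2)]]])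
      (simp add: inner_diff_left assms(3))
  then show "P x = Q x" by simp
qed

section \<open>The Hausdorff moment problem\<close>

lemma moment_binomial_expansion:
  fixes m :: "nat \<Rightarrow> nat \<Rightarrow> real"
  assumes rec: "\<And>j i. m j i = m (Suc j) i + m j (Suc i)"
  shows "m p q = (\<Sum>i\<le>r. real (r choose i) * m (p + i) (q + (r - i)))"
proof (induction r arbitrary: p q)
  case (Suc r)
  let ?a = "\<lambda>i. m (p + i) (q + (Suc r - i))"
  have 1: "(\<Sum>i\<le>r. real (r choose i) * m (Suc p + i) (q + (r - i))) =
      (\<Sum>i\<le>r. real (r choose i) * ?a (Suc i))" by simp
  have "(\<Sum>i\<le>r. real (r choose i) * m (p + i) (Suc q + (r - i)))
      = (\<Sum>i\<le>Suc r. real (r choose i) * ?a i)"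
    by (simp add: binomial_eq_0 Suc_diff_le)
  also have "\<dots> = ?a 0 + (\<Sum>i\<le>r. real (r choose Suc i) * ?a (Suc i))"
    by (subst sum.atMost_Suc_shift) simp
  finally have 2: "(\<Sum>i\<le>r. real (r choose i) * m (p + i) (Suc q + (r - i)))
      = ?a 0 + (\<Sum>i\<le>r. real (r choose Suc i) * ?a (Suc i))" .
  have "(\<Sum>i\<le>Suc r. real (Suc r choose i) * ?a i)
     = ?a 0 + (\<Sum>i\<le>r. real (Suc r choose Suc i) * ?a (Suc i))"
    by (subst sum.atMost_Suc_shift) simp
  also have "\<dots> = ?a 0 + (\<Sum>i\<le>r. real (r choose i) * ?a (Suc i)) + (\<Sum>i\<le>r. real (r choose Suc i) * ?a (Suc i))"
    by (simp add: sum.distrib algebra_simps)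
  also have "\<dots> = m (Suc p) q + m p (Suc q)"
    using Suc.IH[of "Suc p" q] Suc.IH[of p "Suc q"] unfolding 1 2 by simp
  finally show ?case using rec[of p q] by simp
qed simp

lemma binomial_ratio_power_bound:
  assumes "j \<le> n" "k < n"
  shows "\<bar>real (j choose k) / real (n choose k) - (real j / real n) ^ k\<bar> \<le> (real k)\<^sup>2 / (real n - real k)"
  using assms(2)
proof (induction k)
  case (Suc k)
  let ?h = "\<lambda>k. real (j choose k) / real (n choose k)"
  have step: "real (m choose Suc k) = real (m choose k) * (real m - real k) / real (Suc k)" for m
    using gbinomial_absorption'[of "Suc k" "real m"] binomial_absorb_comp[of m k]
    by (simp add: binomial_gbinomial gbinomial_mult_1 field_simps)
  have nk: "n choose k \<noteq> 0" "real n - real k > 0" using Suc.prems by auto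
  have h: "?h (Suc k) = ?h k * ((real j - real k) / (real n - real k))"
  proof -
    have "(a * x / s) / (b * y / s) = (a / b) * (x / y)" if "s \<noteq> 0" for a b x y s :: real
      using that by simp
    then show ?thesis unfolding step by simp
  qed
  have h1: "\<bar>?h k\<bar> \<le> 1"
    using nk assms(1) binomial_right_mono[of j n k] by (simp add: divide_simps)
  have q: "\<bar>(real j - real k) / (real n - real k) - real j / real n\<bar> \<le> real k / (real n - real k)"
  proof -
    have "(real j - real k) / (real n - real k) - real j / real n = - (real k / (real n - real k)) * ((real n - real j) / real n)"
      using nk Suc.prems by (simp add: field_simps)
    also have "\<bar>\<dots>\<bar> = real k / (real n - real k) * \<bar>(real n - real j) / real n\<bar>"
      using nk by (simp add: abs_mult)
    also have "\<dots> \<le> real k / (real n - real k) * 1"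
      using nk assms(1) by (intro mult_left_mono) (auto simp: divide_simps)
    finally show ?thesis by simp
  qed
  have "?h (Suc k) - (real j / real n) ^ Suc k
     = (?h k - (real j / real n) ^ k) * (real j / real n) + ?h k * ((real j - real k) / (real n - real k) - real j / real n)"
    unfolding h by (simp add: algebra_simps)
  also have "\<bar>\<dots>\<bar> \<le> \<bar>?h k - (real j / real n) ^ k\<bar> * \<bar>real j / real n\<bar> + \<bar>?h k\<bar> * \<bar>(real j - real k) / (real n - real k) - real j / real n\<bar>"
    by (rule order_trans[OF abs_triangle_ineq]) (simp only: abs_mult order_refl)
  also have "\<dots> \<le> (real k)\<^sup>2 / (real n - real k) * 1 + 1 * (real k / (real n - real k))"
  proof (intro add_mono mult_mono h1 q)
    show "\<bar>?h k - (real j / real n) ^ k\<bar> \<le> (real k)\<^sup>2 / (real n - real k)"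
      using Suc.IH Suc.prems by simp
    show "\<bar>real j / real n\<bar> \<le> 1" using assms(1) by (auto simp: divide_le_eq_1)
  qed (use nk in auto)
  also have "\<dots> = ((real k)\<^sup>2 + real k) / (real n - real k)" by (simp add: add_divide_distrib)
  also have "\<dots> \<le> (real (Suc k))\<^sup>2 / (real n - real (Suc k))"
    using Suc.prems by (intro frac_le) (auto simp: power2_eq_square algebra_simps)
  finally show ?case .
qed simp

text \<open>The measure is a weak limit of the measures with weight (n choose j) m j (n - j) at the point j / n;
  their k-th factorial moments equal m k 0 exactly.\<close>
theorem Hausdorff_moment:
  fixes m :: "nat \<Rightarrow> nat \<Rightarrow> real"
  assumes rec: "\<And>j i. m j i = m (Suc j) i + m j (Suc i)"
    and nonneg: "\<And>j i. m j i \<ge> 0" and one: "m 0 0 = 1"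
  obtains M where "real_distribution M" "AE t in M. t \<in> {0..1}" "\<And>k. (LINT t|M. t ^ k) = m k 0"
proof -
  define w where "w n j = real (n choose j) * m j (n - j)" for n j
  have w0: "w n j \<ge> 0" for n j by (simp add: w_def nonneg)
  have w1: "(\<Sum>j\<le>n. w n j) = 1" for n
    using moment_binomial_expansion[of m 0 0 n, OF rec] one by (simp add: w_def)
  have wk: "m k 0 = (\<Sum>j\<le>n. w n j * (real (j choose k) / real (n choose k)))" if "k \<le> n" for k n
  proof -
    have "m k 0 = (\<Sum>i\<le>n - k. real (n - k choose i) * m (k + i) (n - k - i))"
      using moment_binomial_expansion[of m k 0 "n - k", OF rec] by simp
    also have "\<dots> = (\<Sum>j\<in>{k..n}. real (n - k choose (j - k)) * m j (n - j))"
      using that by (intro sum.reindex_bij_witness[of _ "\<lambda>j. j - k" "\<lambda>i. k + i"]) auto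
    also have "\<dots> = (\<Sum>j\<in>{k..n}. w n j * (real (j choose k) / real (n choose k)))"
    proof (rule sum.cong)
      fix j assume j: "j \<in> {k..n}"
      then have "real (n choose j) * real (j choose k) = real (n choose k) * real (n - k choose (j - k))"
        using choose_mult[of k j n] by (metis atLeastAtMost_iff of_nat_mult)
      then show "real (n - k choose (j - k)) * m j (n - j) = w n j * (real (j choose k) / real (n choose k))"
        using that by (simp add: w_def field_simps)
    qed simp
    also have "\<dots> = (\<Sum>j\<le>n. w n j * (real (j choose k) / real (n choose k)))"
      by (intro sum.mono_neutral_left) (auto simp: not_le binomial_eq_0)
    finally show ?thesis .
  qed
  define \<mu> where "\<mu> n = distr (point_measure {..n} (w n)) borel (\<lambda>j. real j / real n)" for n
  have int_\<mu>: "(LINT t|\<mu> n. f t) = (\<Sum>j\<le>n. w n j * f (real j / real n))"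
    if "f \<in> borel_measurable borel" for f :: "real \<Rightarrow> real" and n
    unfolding \<mu>_def using that
    by (subst integral_distr) (auto simp: lebesgue_integral_point_measure_finite w0 measurable_point_measure_eq1)
  have dist: "real_distribution (\<mu> n)" for n
  proof -
    interpret prob_space "point_measure {..n} (w n)"
    proof
      have "emeasure (point_measure {..n} (w n)) (space (point_measure {..n} (w n))) = (\<Sum>j\<le>n. ennreal (w n j))"
        by (simp add: space_point_measure emeasure_point_measure_finite)
      also have "\<dots> = ennreal (\<Sum>j\<le>n. w n j)" by (rule sum_ennreal) (simp add: w0)
      finally show "emeasure (point_measure {..n} (w n)) (space (point_measure {..n} (w n))) = 1"
        by (simp add: w1)
    qed
    show ?thesis unfolding \<mu>_def
      by (intro real_distribution_distr) (auto simp: measurable_point_measure_eq1)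
  qed
  have supp: "measure (\<mu> n) {0..1} = 1" for n
  proof -
    have "measure (\<mu> n) {0..1} = (LINT t|\<mu> n. indicat_real {0..1} t)"
      using real_distribution.events_eq_borel[OF dist] real_distribution.space_eq_univ[OF dist] by simp
    also have "\<dots> = (\<Sum>j\<le>n. w n j * 1)"
      by (subst int_\<mu>) (auto intro!: sum.cong simp: indicator_def divide_simps)
    finally show ?thesis by (simp add: w1)
  qed
  have "tight \<mu>"
    unfolding tight_def
  proof (intro conjI allI impI dist)
    fix e :: real assume "e > 0"
    have "1 - e < measure (\<mu> n) {-1<..1}" for n
    proof -
      interpret real_distribution "\<mu> n" by (rule dist)
      have "measure (\<mu> n) {0..1} \<le> measure (\<mu> n) {-1<..1}"
        by (intro finite_measure_mono) auto
      then show ?thesis using supp[of n] \<open>e > 0\<close> by simp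
    qed
    then show "\<exists>a b. a < b \<and> (\<forall>n. 1 - e < measure (\<mu> n) {a<..b})" by (intro exI[of _ "-1"] exI[of _ 1]) auto
  qed
  then obtain r M where r: "strict_mono (r::nat\<Rightarrow>nat)" and M: "real_distribution M" and
      conv: "weak_conv_m (\<mu> \<circ> id \<circ> r) M"
    using tight_imp_convergent_subsubsequence[of \<mu> id] by (auto simp: strict_mono_id)
  interpret M: real_distribution M by (rule M)
  define c where "c t = max 0 (min 1 t)" for t :: real
  have c01: "0 \<le> c t" "c t \<le> 1" for t by (auto simp: c_def)
  have ccont: "isCont c t" for t unfolding c_def by (intro continuous_intros)
  have lim: "(\<lambda>n. LINT t|\<mu> (r n). f t) \<longlonglongrightarrow> (LINT t|M. f t)"
    if "\<And>t. isCont f t" "\<And>t. \<bar>f t\<bar> \<le> B" for f :: "real \<Rightarrow> real" and B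
    using weak_conv_imp_integral_bdd_continuous_conv[OF _ M conv, of f B] dist that by (simp add: o_def)
  have meas: "f \<in> borel_measurable borel" if "\<And>t. isCont f t" for f :: "real \<Rightarrow> real"
    using that by (intro borel_measurable_continuous_onI) (simp add: continuous_on_eq_continuous_at)
  have jn: "c (real j / real n) = real j / real n" if "j \<le> n" for j n
    using that by (cases "n = 0") (auto simp: c_def divide_simps)
  have supp_M: "AE t in M. t \<in> {0..1}"
  proof -
    define g where "g t = min 1 \<bar>t - c t\<bar>" for t
    have g: "isCont g t" "\<bar>g t\<bar> \<le> 1" "0 \<le> g t" for t
      unfolding g_def by (auto intro!: continuous_intros ccont)
    have "(LINT t|\<mu> (r n). g t) = 0" for n
      unfolding int_\<mu>[OF meas[OF g(1)]] by (intro sum.neutral) (auto simp: g_def jn)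
    then have "(LINT t|M. g t) = 0" using lim[OF g(1,2)] by (simp add: LIMSEQ_const_iff)
    moreover have "integrable M g"
      using meas[OF g(1)] g(2) by (intro M.integrable_const_bound[where B = 1]) auto
    ultimately have "AE t in M. g t = 0"
      using integral_nonneg_eq_0_iff_AE[of M g] g(3) by simp
    then show ?thesis by eventually_elim (auto simp: g_def c_def split: if_splits)
  qed
  have "(LINT t|M. t ^ k) = m k 0" for k
  proof -
    have ck: "isCont (\<lambda>t. c t ^ k) t" "\<bar>c t ^ k\<bar> \<le> 1" for t
      using c01 by (auto intro!: continuous_intros ccont power_le_one simp: power_abs)
    have "(\<lambda>n. LINT t|\<mu> n. c t ^ k) \<longlonglongrightarrow> m k 0"
    proof (rule Lim_transform2[OF tendsto_const])
      have "\<bar>m k 0 - (LINT t|\<mu> n. c t ^ k)\<bar> \<le> (real k)\<^sup>2 / (real n - real k)" if n: "n > k" for n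
      proof -
        have "m k 0 - (LINT t|\<mu> n. c t ^ k) =
          (\<Sum>j\<le>n. w n j * (real (j choose k) / real (n choose k) - (real j / real n) ^ k))"
          unfolding int_\<mu>[OF meas[OF ck(1)]] wk[OF less_imp_le[OF n]]
          by (simp add: sum_subtractf[symmetric] right_diff_distrib jn)
        also have "\<bar>\<dots>\<bar> \<le> (\<Sum>j\<le>n. w n j * ((real k)\<^sup>2 / (real n - real k)))"
          using binomial_ratio_power_bound[OF _ n] w0
          by (intro sum_norm_le[where 'a = real, simplified])
            (auto simp: abs_mult simp del: times_divide_eq_right intro!: mult_left_mono)
        also have "\<dots> = (real k)\<^sup>2 / (real n - real k)"
          using w1[of n] by (simp only: sum_distrib_right[symmetric] mult_1)
        finally show ?thesis .
      qed
      then have "eventually (\<lambda>n. norm (m k 0 - (LINT t|\<mu> n. c t ^ k)) \<le> (real k)\<^sup>2 / (real n - real k)) sequentially"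
        by (intro eventually_mono[OF eventually_gt_at_top[of k]]) simp
      moreover have "(\<lambda>n. (real k)\<^sup>2 / (real n - real k)) \<longlonglongrightarrow> 0" by real_asymp
      ultimately show "(\<lambda>n. m k 0 - (LINT t|\<mu> n. c t ^ k)) \<longlonglongrightarrow> 0"
        by (rule Lim_null_comparison)
    qed
    then have "(\<lambda>n. LINT t|\<mu> (r n). c t ^ k) \<longlonglongrightarrow> m k 0"
      using LIMSEQ_subseq_LIMSEQ[OF _ r] by (force simp: o_def)
    then have "(LINT t|M. c t ^ k) = m k 0"
      using lim[OF ck] LIMSEQ_unique by blast
    moreover have "(LINT t|M. c t ^ k) = (LINT t|M. t ^ k)"
      using supp_M meas[OF ck(1)] by (intro integral_cong_AE) (auto simp: c_def)
    ultimately show ?thesis by simp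
  qed
  then show thesis using that M supp_M by blast
qed

section \<open>The spectral theorem\<close>

lemma funpow_commute:
  assumes "\<And>x. f (g x) = g (f x)" shows "(f ^^ n) (g x) = g ((f ^^ n) x)"
  by (induction n) (simp_all add: assms)

lemma selfadjoint_funpow:
  assumes "selfadjoint A" shows "selfadjoint (A ^^ n)"
proof (induction n)
  case 0
  then show ?case using selfadjoint_id by (simp add: id_def)
next
  case (Suc n)
  have "selfadjoint (\<lambda>x. A ((A ^^ n) x))"
    by (rule selfadjoint_compose[OF assms Suc]) (simp add: funpow_swap1)
  then show ?case by (simp add: o_def)
qed

lemma selfadjoint_sum:
  assumes "\<And>i. i \<in> I \<Longrightarrow> selfadjoint (F i)" shows "selfadjoint (\<lambda>x. \<Sum>i\<in>I. F i x)"
  using assms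
proof (induction I rule: infinite_finite_induct)
  case (insert i I)
  then show ?case using selfadjoint_add[of "F i" "\<lambda>x. \<Sum>i\<in>I. F i x"] by simp
next
qed (use selfadjoint_scaleR[OF selfadjoint_id, of 0] in simp_all)

lemma contraction_powers_nonneg:
  assumes A: "selfadjoint A" and A0: "\<And>x. inner (A x) x \<ge> 0" and A1: "\<And>x. inner (A x) x \<le> (norm x)\<^sup>2"
  shows "inner ((A ^^ j) (((\<lambda>x. x - A x) ^^ i) x)) x \<ge> 0"
proof -
  define B where "B = (\<lambda>x. x - A x)"
  have B: "selfadjoint B" unfolding B_def by (intro selfadjoint_diff selfadjoint_id A)
  note lA = selfadjoint_simps[OF A] and lB = selfadjoint_simps[OF B]
  have AB: "A (B x) = B (A x)" for x by (simp add: B_def lA)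
  have ABi: "A ((B ^^ i) x) = (B ^^ i) (A x)" for i x using funpow_commute[of B A i x] AB by simp
  have B0: "inner (B x) x \<ge> 0" for x using A1[of x] by (simp add: B_def inner_diff_left power2_norm_eq_inner)
  have base0: "inner ((B ^^ i) x) x \<ge> 0" for i x
  proof (induction i arbitrary: x rule: induct_nat_012)
    case (ge2 n)
    have "(B ^^ Suc (Suc n)) x = B ((B ^^ n) (B x))"
      by (simp add: funpow_swap1)
    then have "inner ((B ^^ Suc (Suc n)) x) x = inner ((B ^^ n) (B x)) (B x)"
      by (simp add: selfadjointD(3)[OF B] del: funpow.simps)
    then show ?case using ge2 by simp
  qed (simp_all add: B0)
  have base1: "inner (A ((B ^^ i) x)) x \<ge> 0" for i x
  proof (induction i arbitrary: x rule: induct_nat_012)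
    case 1
    \<comment> \<open>A B is a sum of positive operators because A + B is the identity.\<close>
    have "A (B x) = A (B (A x)) + A (B (B x))"
      by (simp add: B_def lA)
    moreover have "inner (A (B (A x))) x = inner (B (A x)) (A x)"
      by (rule selfadjointD(3)[OF A])
    moreover have "inner (A (B (B x))) x = inner (A (B x)) (B x)"
      unfolding AB[of "B x"] by (rule selfadjointD(3)[OF B])
    ultimately have "inner (A (B x)) x = inner (B (A x)) (A x) + inner (A (B x)) (B x)"
      by (simp only: inner_add_left)
    then show ?case using B0[of "A x"] A0[of "B x"] by simp
  next
    case (ge2 n)
    have "(B ^^ Suc (Suc n)) x = B ((B ^^ n) (B x))"
      by (simp add: funpow_swap1)
    then have "inner (A ((B ^^ Suc (Suc n)) x)) x = inner (A ((B ^^ n) (B x))) (B x)"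
      by (simp add: AB selfadjointD(3)[OF B] del: funpow.simps)
    then show ?case using ge2 by simp
  qed (simp_all add: A0)
  have "inner ((A ^^ j) ((B ^^ i) x)) x \<ge> 0"
  proof (induction j arbitrary: x rule: induct_nat_012)
    case (ge2 n)
    have "(A ^^ Suc (Suc n)) ((B ^^ i) x) = A ((A ^^ n) ((B ^^ i) (A x)))"
      by (simp add: funpow_swap1 ABi)
    then have "inner ((A ^^ Suc (Suc n)) ((B ^^ i) x)) x = inner ((A ^^ n) ((B ^^ i) (A x))) (A x)"
      by (simp add: selfadjointD(3)[OF A] del: funpow.simps)
    then show ?case using ge2 by simp
  qed (simp_all add: base0 base1)
  then show ?thesis by (simp add: B_def)
qed

lemma contraction_moment_measure:
  assumes A: "selfadjoint A" and A0: "\<And>x. inner (A x) x \<ge> 0" and A1: "\<And>x. inner (A x) x \<le> (norm x)\<^sup>2"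
  obtains M where "sets M = sets (borel :: real measure)" "finite_measure M" "AE t in M. t \<in> {0..1}"
    "\<And>k. (LINT t|M. t ^ k) = inner ((A ^^ k) x) x"
proof (cases "x = 0")
  case True
  let ?M = "density lborel (\<lambda>_. 0) :: real measure"
  show ?thesis
  proof (rule that[of ?M])
    show "finite_measure ?M" by (rule finite_measureI) (simp add: emeasure_density)
    show "(LINT t|?M. t ^ k) = inner ((A ^^ k) x) x" for k
      using integral_density[of "\<lambda>t::real. t ^ k" lborel "\<lambda>_. 0"] True by simp
  qed (auto simp: AE_density)
next
  case False
  define u where "u = x /\<^sub>R norm x"
  define B where "B = (\<lambda>x. x - A x)"
  define m where "m j i = inner ((A ^^ j) ((B ^^ i) u)) u" for j i
  note lA = selfadjoint_simps[OF selfadjoint_funpow[OF A]]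
  have rec: "m j i = m (Suc j) i + m j (Suc i)" for j i
  proof -
    have "(A ^^ j) ((B ^^ Suc i) u) = (A ^^ j) ((B ^^ i) u) - (A ^^ j) (A ((B ^^ i) u))"
      by (simp add: B_def lA)
    then show ?thesis by (simp add: m_def inner_diff_left funpow_swap1)
  qed
  have "norm u = 1" using False by (simp add: u_def)
  then have one: "m 0 0 = 1" by (simp add: m_def power2_norm_eq_inner[symmetric])
  have nonneg: "m j i \<ge> 0" for j i
    unfolding m_def B_def by (rule contraction_powers_nonneg[OF A A0 A1])
  obtain M where M: "real_distribution M" "AE t in M. t \<in> {0..1}" "\<And>k. (LINT t|M. t ^ k) = m k 0"
    using Hausdorff_moment[of m] rec nonneg one by metis
  interpret real_distribution M by (rule M)
  let ?M = "density M (\<lambda>_. ennreal ((norm x)\<^sup>2))"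
  have x: "x = norm x *\<^sub>R u" using False by (simp add: u_def)
  show ?thesis
  proof (rule that[of ?M])
    show "finite_measure ?M"
      by (rule finite_measureI) (simp add: emeasure_density nn_integral_cmult emeasure_space_1 ennreal_mult_eq_top_iff)
    show "AE t in ?M. t \<in> {0..1}" using M(2) by (simp add: AE_density)
    show "(LINT t|?M. t ^ k) = inner ((A ^^ k) x) x" for k
    proof -
      have "(LINT t|?M. t ^ k) = (norm x)\<^sup>2 * (LINT t|M. t ^ k)"
        by (subst integral_density) auto
      also have "\<dots> = (norm x)\<^sup>2 * inner ((A ^^ k) u) u" by (simp add: M(3) m_def)
      also have "\<dots> = inner ((A ^^ k) (norm x *\<^sub>R u)) (norm x *\<^sub>R u)"
        by (simp only: lA inner_scaleR_left inner_scaleR_right power2_eq_square mult.assoc)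
      finally show ?thesis using x by simp
    qed
  qed simp
qed

lemma orth_projection_limit:
  assumes G: "\<And>j::nat. selfadjoint (G j)" and lim: "\<And>x. (\<lambda>j. G j x) \<longlonglongrightarrow> P x"
    and nP: "\<And>x. inner (P x) x = (norm (P x))\<^sup>2"
  shows "orth_projection P"
proof (rule orth_projectionI)
  note lG = selfadjoint_simps[OF G]
  have add: "P (x + y) = P x + P y" for x y
    using LIMSEQ_unique[OF lim[of "x + y"]] tendsto_add[OF lim[of x] lim[of y]] by (simp add: lG)
  have scaleR: "P (r *\<^sub>R x) = r *\<^sub>R P x" for r x
    using LIMSEQ_unique[OF lim[of "r *\<^sub>R x"]] tendsto_scaleR[OF tendsto_const lim[of x]] by (simp add: lG)
  have scaleC: "P (c *\<^sub>C x) = c *\<^sub>C P x" for c x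
    using LIMSEQ_unique[OF lim[of "c *\<^sub>C x"]] bounded_linear.tendsto[OF bounded_linear_scaleC lim[of x]] by (simp add: lG)
  have sym: "inner (P x) y = inner x (P y)" for x y
    using LIMSEQ_unique[OF tendsto_inner[OF lim[of x] tendsto_const[of y]]]
      tendsto_inner[OF tendsto_const[of x] lim[of y]] by (simp add: selfadjointD(3)[OF G])
  have le: "norm (P x) * norm (P x) \<le> norm (P x) * norm x" for x
    using nP[of x] norm_cauchy_schwarz[of "P x" x] by (simp add: power2_eq_square)
  have "norm (P x) \<le> norm x * 1" for x
  proof (cases "P x = 0")
    case False
    then show ?thesis using mult_left_le_imp_le[OF le[of x]] by simp
  qed simp
  then have "bounded_linear P"
    by (intro bounded_linear_intro add scaleR)
  then show P: "selfadjoint P"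
    by (intro selfadjointI sym) (auto simp: bounded_clinear_def scaleC)
  have "selfadjoint (\<lambda>x. P (P x) - P x)"
    by (rule selfadjoint_diff[OF selfadjoint_compose[OF P P refl] P])
  moreover have "inner (P (P x) - P x) x = 0" for x
    using nP[of x] by (simp add: inner_diff_left sym[of "P x" x] power2_norm_eq_inner)
  ultimately have "P (P x) - P x = 0" for x
    by (rule selfadjoint_form_zero)
  then show "P (P x) = P x" for x by simp
qed

lemma orth_projection_sum:
  assumes P: "\<And>i::nat. orth_projection (P i)" and q: "\<And>x. (\<lambda>i. inner (P i x) x) sums q x"
    and le: "\<And>x. q x \<le> (norm (x::'a::complex_hilbert_space))\<^sup>2"
  obtains R where "orth_projection R" "\<And>x. (\<lambda>i. P i x) sums R x" "\<And>x. inner (R x) x = q x"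
proof -
  have "P i (P j x) = 0" if "i \<noteq> j" for i j x
  proof -
    let ?y = "P j x"
    have "(\<Sum>k\<in>{i,j}. inner (P k ?y) ?y) \<le> (norm ?y)\<^sup>2"
      using sum_le_suminf[OF sums_summable[OF q[of ?y]], of "{i,j}"] orth_projectionD(3)[OF P]
        sums_unique[OF q[of ?y]] le[of ?y] by simp
    then show ?thesis
      using that by (simp add: orth_projectionD(2,3)[OF P])
  qed
  then have orth: "inner (P i x) (P j x) = 0" if "i \<noteq> j" for i j x
    using that by (simp add: selfadjointD(3)[OF orth_projectionD(1)[OF P]])
  have pyth: "(norm (\<Sum>i\<in>I. P i x))\<^sup>2 = (\<Sum>i\<in>I. inner (P i x) x)" if "finite I" for I x
    using norm_sum_Pythagorean[OF that, of "\<lambda>i. P i x"] orth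
    by (auto simp: pairwise_def orthogonal_def orth_projectionD(3)[OF P])
  have sm: "summable (\<lambda>i. P i x)" for x
    unfolding summable_Cauchy
  proof (intro allI impI)
    fix e :: real assume e: "e > 0"
    then obtain N where N: "\<And>m n. m \<ge> N \<Longrightarrow> norm (\<Sum>i\<in>{m..<n}. inner (P i x) x) < e\<^sup>2"
      using sums_summable[OF q[of x]] unfolding summable_Cauchy by (metis zero_less_power)
    have "norm (\<Sum>i\<in>{m..<n}. P i x) < e" if "m \<ge> N" for m n
    proof (rule power2_less_imp_less)
      show "(norm (\<Sum>i\<in>{m..<n}. P i x))\<^sup>2 < e\<^sup>2"
        using N[OF that, of n] by (simp add: pyth)
    qed (use e in simp)
    then show "\<exists>N. \<forall>m\<ge>N. \<forall>n. norm (\<Sum>i\<in>{m..<n}. P i x) < e" by blast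
  qed
  define R where "R x = (\<Sum>i. P i x)" for x
  have R: "(\<lambda>i. P i x) sums R x" for x unfolding R_def using sm by (rule summable_sums)
  have form: "inner (R x) x = q x" for x
    using sums_unique2[OF bounded_linear.sums[OF bounded_linear_inner_left R] q] .
  have "(norm (R x))\<^sup>2 = q x" for x
  proof (rule LIMSEQ_unique)
    show "(\<lambda>n. (norm (\<Sum>i<n. P i x))\<^sup>2) \<longlonglongrightarrow> (norm (R x))\<^sup>2"
      using R[of x] unfolding sums_def by (intro tendsto_intros)
    show "(\<lambda>n. (norm (\<Sum>i<n. P i x))\<^sup>2) \<longlonglongrightarrow> q x"
      using q[of x] unfolding sums_def by (simp add: pyth)
  qed
  then have "orth_projection R"
    using form R[unfolded sums_def] orth_projectionD(1)[OF P]
    by (intro orth_projection_limit[of "\<lambda>n x. \<Sum>i<n. P i x" R] selfadjoint_sum) auto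
  then show thesis using that R form by blast
qed

lemma contraction_cutoff_projection:
  fixes A :: "'a::complex_hilbert_space \<Rightarrow> 'a" and M :: "'a \<Rightarrow> real measure"
  assumes A: "selfadjoint A"
    and sets: "\<And>x. sets (M x) = sets borel" and fin: "\<And>x. finite_measure (M x)"
    and supp: "\<And>x. AE t in M x. t \<in> {0..1}"
    and mom: "\<And>x k. (LINT t|M x. t ^ k) = inner ((A ^^ k) x) x"
  obtains P where "orth_projection P" "\<And>x. inner (P x) x = measure (M x) {..c}"
    "\<And>L x. subspace L \<Longrightarrow> closed L \<Longrightarrow> A ` L \<subseteq> L \<Longrightarrow> x \<in> L \<Longrightarrow> P x \<in> L"
proof -
  note lA = selfadjoint_simps[OF selfadjoint_funpow[OF A]]
  define f where "f j t = max 0 (min 1 (1 - real j * (t - c)))" for j t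
  have "\<exists>a n. \<forall>t\<in>{0..1}. \<bar>f j t - (\<Sum>i\<le>n. a i * t ^ i)\<bar> < 1 / real (Suc j)" for j
  proof -
    have "continuous_on {0..1} (f j)" unfolding f_def by (intro continuous_intros)
    then obtain g where "real_polynomial_function g" "\<And>t. t \<in> {0..1} \<Longrightarrow> \<bar>f j t - g t\<bar> < 1 / real (Suc j)"
      by (rule Stone_Weierstrass_real_polynomial_function[OF compact_Icc, of 0 1 "f j" "1 / real (Suc j)"]) auto
    then show ?thesis unfolding real_polynomial_function_iff_sum by blast
  qed
  then obtain a n where an: "\<And>j t. t \<in> {0..1} \<Longrightarrow> \<bar>f j t - (\<Sum>i\<le>n j. a j i * t ^ i)\<bar> < 1 / real (Suc j)"
    by metis
  define g where "g j t = (\<Sum>i\<le>n j. a j i * t ^ i)" for j and t :: real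
  define G where "G j x = (\<Sum>i\<le>n j. a j i *\<^sub>R (A ^^ i) x)" for j x
  define h where "h = indicat_real {..c}"
  have G: "selfadjoint (G j)" for j
    unfolding G_def by (intro selfadjoint_sum selfadjoint_scaleR selfadjoint_funpow A)
  note [measurable_cong] = sets
  have g_meas[measurable]: "g j \<in> borel_measurable borel" for j
    unfolding g_def by measurable
  have h_meas[measurable]: "h \<in> borel_measurable borel" unfolding h_def by measurable
  have g_lim: "(\<lambda>j. g j t) \<longlonglongrightarrow> h t" if t: "t \<in> {0..1}" for t
  proof -
    have "(\<lambda>j. f j t) \<longlonglongrightarrow> h t"
    proof (cases "t \<le> c")
      case True
      then have "f j t = 1" for j by (auto simp: f_def mult_nonneg_nonpos)
      then show ?thesis using True by (simp add: h_def)
    next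
      case False
      have "eventually (\<lambda>j. f j t = 0) sequentially"
        using eventually_ge_at_top[of "nat \<lceil>1 / (t - c)\<rceil>"]
      proof eventually_elim
        case (elim j)
        then have "1 / (t - c) \<le> real j" by linarith
        then show ?case using False by (simp add: f_def field_simps)
      qed
      then show ?thesis using False by (simp add: h_def tendsto_eventually)
    qed
    moreover have "(\<lambda>j. g j t - f j t) \<longlonglongrightarrow> 0"
    proof (rule Lim_null_comparison)
      show "eventually (\<lambda>j. norm (g j t - f j t) \<le> 1 / real (Suc j)) sequentially"
        using an[OF t] by (intro always_eventually allI) (simp add: g_def abs_minus_commute less_imp_le)
      show "(\<lambda>j. 1 / real (Suc j)) \<longlonglongrightarrow> 0" by real_asymp
    qed
    ultimately show ?thesis using tendsto_add by fastforce
  qed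
  have g2: "\<bar>g j t\<bar> \<le> 2" if "t \<in> {0..1}" for j t
  proof -
    have "\<bar>f j t\<bar> \<le> 1" by (simp add: f_def)
    moreover have "1 / real (Suc j) \<le> 1" by simp
    ultimately show ?thesis using an[OF that, of j] unfolding g_def by linarith
  qed
  have m22: "\<bar>u * v\<bar> \<le> 4" if "\<bar>u\<bar> \<le> 2" "\<bar>v\<bar> \<le> 2" for u v :: real
    using mult_mono[OF that] by (simp add: abs_mult)
  have h1: "\<bar>h t\<bar> \<le> 1" for t by (simp add: h_def indicator_def)
  have bdd: "integrable (M x) k" if "k \<in> borel_measurable borel" "\<And>t. t \<in> {0..1} \<Longrightarrow> \<bar>k t\<bar> \<le> B" for x B and k :: "real \<Rightarrow> real"
    using that(2) supp[of x] by (intro finite_measure.integrable_const_bound[OF fin, where B = B])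
      (auto simp: measurable_cong_sets[OF sets refl] that(1))
  have int_pow: "integrable (M x) (\<lambda>t. t ^ k)" for x k
    by (rule bdd[of _ 1]) (auto simp: power_abs intro!: power_le_one)
  have GG: "inner (G j x) (G k x) = (LINT t|M x. g j t * g k t)" for j k x
  proof -
    have "inner ((A ^^ i) x) ((A ^^ l) x) = inner ((A ^^ (l + i)) x) x" for i l
      by (simp only: funpow_add o_apply) (rule selfadjointD(3)[OF selfadjoint_funpow[OF A], symmetric])
    then have "inner (G j x) (G k x) = (\<Sum>i\<le>n j. \<Sum>l\<le>n k. a j i * a k l * inner ((A ^^ (l + i)) x) x)"
      unfolding G_def inner_sum_left by (simp only: inner_sum_right inner_scaleR_left inner_scaleR_right mult_ac)
    also have "\<dots> = (\<Sum>i\<le>n j. \<Sum>l\<le>n k. a j i * a k l * (LINT t|M x. t ^ (l + i)))" by (simp only: mom)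
    also have "\<dots> = (LINT t|M x. (\<Sum>i\<le>n j. \<Sum>l\<le>n k. a j i * a k l * t ^ (l + i)))"
      using int_pow[of x] by simp
    also have "\<dots> = (LINT t|M x. g j t * g k t)"
      by (simp add: g_def sum_product power_add mult_ac)
    finally show ?thesis .
  qed
  have G1: "inner (G j x) x = (LINT t|M x. g j t)" for j x
    using int_pow[of x] by (simp add: G_def g_def inner_sum_left mom[symmetric])
  have int_lim: "(\<lambda>j. LINT t|M x. F (g j t) (h t)) \<longlonglongrightarrow> (LINT t|M x. F (h t) (h t))"
    if F: "continuous_on UNIV (\<lambda>p. F (fst p) (snd p))" and B: "\<And>u v. \<bar>u\<bar> \<le> 2 \<Longrightarrow> \<bar>v\<bar> \<le> 1 \<Longrightarrow> \<bar>F u v\<bar> \<le> B"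
    for F :: "real \<Rightarrow> real \<Rightarrow> real" and B x
  proof (rule integral_dominated_convergence[where w = "\<lambda>_. B"])
    have F_meas: "(\<lambda>t. F (p t) (q t)) \<in> borel_measurable borel"
      if "p \<in> borel_measurable borel" "q \<in> borel_measurable borel" for p q :: "real \<Rightarrow> real"
      using borel_measurable_continuous_Pair[OF that F] .
    show "(\<lambda>t. F (h t) (h t)) \<in> borel_measurable (M x)" "\<And>j. (\<lambda>t. F (g j t) (h t)) \<in> borel_measurable (M x)"
      by (auto simp: measurable_cong_sets[OF sets refl] intro!: F_meas)
    show "integrable (M x) (\<lambda>_. B)" by (rule finite_measure.integrable_const[OF fin])
    show "AE t in M x. (\<lambda>j. F (g j t) (h t)) \<longlonglongrightarrow> F (h t) (h t)"
      using supp[of x]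
    proof eventually_elim
      case (elim t)
      have "(\<lambda>j. (g j t, h t)) \<longlonglongrightarrow> (h t, h t)" by (intro tendsto_intros g_lim elim)
      then show ?case
        using continuous_on_tendsto_compose[OF F, of "\<lambda>j. (g j t, h t)" "(h t, h t)" sequentially] by simp
    qed
    show "AE t in M x. norm (F (g j t) (h t)) \<le> B" for j
      using supp[of x] by eventually_elim (simp add: B g2 h1)
  qed
  define d where "d j x = (LINT t|M x. (g j t - h t)\<^sup>2)" for j x
  have d0: "(\<lambda>j. d j x) \<longlonglongrightarrow> 0" for x
  proof -
    have "\<bar>(u - v)\<^sup>2\<bar> \<le> 9" if "\<bar>u\<bar> \<le> 2" "\<bar>v\<bar> \<le> 1" for u v :: real
      using that abs_le_square_iff[of "u - v" 3] by auto
    then show ?thesis unfolding d_def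
      using int_lim[of "\<lambda>u v. (u - v)\<^sup>2" 9 x] by (simp add: continuous_intros)
  qed
  have cau: "(norm (G j x - G k x))\<^sup>2 \<le> 2 * d j x + 2 * d k x" for j k x
  proof -
    have ib: "integrable (M x) (\<lambda>t. g j t * g k t)" for j k
      using g2 by (intro bdd[of _ 4]) (auto intro!: m22)
    have ic: "integrable (M x) (\<lambda>t. (g j t - h t)\<^sup>2)" for j
    proof (rule bdd)
      fix t :: real assume "t \<in> {0..1}"
      then show "\<bar>(g j t - h t)\<^sup>2\<bar> \<le> 9" using g2[of t j] h1[of t] abs_le_square_iff[of "g j t - h t" 3] by auto
    qed measurable
    have "(norm (G j x - G k x))\<^sup>2 = inner (G j x) (G j x) - inner (G j x) (G k x) - inner (G k x) (G j x) + inner (G k x) (G k x)"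
      by (simp add: power2_norm_eq_inner inner_diff)
    also have "\<dots> = (LINT t|M x. g j t * g j t - g j t * g k t - g k t * g j t + g k t * g k t)"
      unfolding GG using ib by (simp add: mult.commute)
    also have "\<dots> \<le> (LINT t|M x. 2 * (g j t - h t)\<^sup>2 + 2 * (g k t - h t)\<^sup>2)"
    proof (rule integral_mono)
      show "g j t * g j t - g j t * g k t - g k t * g j t + g k t * g k t \<le> 2 * (g j t - h t)\<^sup>2 + 2 * (g k t - h t)\<^sup>2" for t
        using zero_le_power2[of "g j t + g k t - 2 * h t"] by (simp add: power2_eq_square algebra_simps)
    qed (use ib ic in auto)
    also have "\<dots> = 2 * d j x + 2 * d k x" unfolding d_def using ic by simp
    finally show ?thesis .
  qed
  have "Cauchy (\<lambda>j. G j x)" for x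
    unfolding Cauchy_def
  proof (intro allI impI)
    fix e :: real assume e: "e > 0"
    have "eventually (\<lambda>j. d j x < e\<^sup>2 / 4) sequentially"
      using order_tendstoD(2)[OF d0[of x], of "e\<^sup>2 / 4"] e by simp
    then obtain N where N: "\<And>j. j \<ge> N \<Longrightarrow> d j x < e\<^sup>2 / 4" unfolding eventually_sequentially by blast
    have "dist (G j x) (G k x) < e" if "j \<ge> N" "k \<ge> N" for j k
      unfolding dist_norm
    proof (rule power2_less_imp_less)
      show "(norm (G j x - G k x))\<^sup>2 < e\<^sup>2" using cau[of j x k] N[OF that(1)] N[OF that(2)] by linarith
    qed (use e in simp)
    then show "\<exists>N. \<forall>j\<ge>N. \<forall>k\<ge>N. dist (G j x) (G k x) < e" by blast
  qed
  then have "\<exists>y. (\<lambda>j. G j x) \<longlonglongrightarrow> y" for x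
    using Cauchy_convergent convergent_def by blast
  then obtain P where P: "\<And>x. (\<lambda>j. G j x) \<longlonglongrightarrow> P x" by metis
  have h: "(LINT t|M x. h t) = measure (M x) {..c}" for x
    using sets_eq_imp_space_eq[OF sets[of x]] by (simp add: h_def)
  have form: "inner (P x) x = measure (M x) {..c}" for x
  proof (rule LIMSEQ_unique)
    show "(\<lambda>j. inner (G j x) x) \<longlonglongrightarrow> inner (P x) x" by (intro tendsto_intros P)
    show "(\<lambda>j. inner (G j x) x) \<longlonglongrightarrow> measure (M x) {..c}"
      using int_lim[of "\<lambda>u v. u" 2 x] by (simp add: G1 h continuous_intros)
  qed
  have "(norm (P x))\<^sup>2 = measure (M x) {..c}" for x
  proof (rule LIMSEQ_unique)
    show "(\<lambda>j. (norm (G j x))\<^sup>2) \<longlonglongrightarrow> (norm (P x))\<^sup>2" by (intro tendsto_intros P)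
    have "(\<lambda>t. h t * h t) = h" by (simp add: h_def indicator_def fun_eq_iff)
    moreover have "(\<lambda>j. LINT t|M x. g j t * g j t) \<longlonglongrightarrow> (LINT t|M x. h t * h t)"
      using int_lim[of "\<lambda>u v. u * u" 4 x] m22 by (force intro: continuous_intros)
    ultimately show "(\<lambda>j. (norm (G j x))\<^sup>2) \<longlonglongrightarrow> measure (M x) {..c}"
      by (simp add: power2_norm_eq_inner GG h)
  qed
  then have "orth_projection P" using orth_projection_limit[OF G P] form by simp
  moreover have "P x \<in> L" if L: "subspace L" "closed L" "A ` L \<subseteq> L" "x \<in> L" for L x
  proof (rule closed_sequentially[OF L(2) _ P])
    have "(A ^^ i) x \<in> L" for i using L(3,4) by (induction i) auto
    then show "G j x \<in> L" for j
      unfolding G_def using L(1) by (intro subspace_sum subspace_scale) auto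
  qed
  ultimately show thesis using that form by blast
qed

lemma sets_borel_eq_sigma_atMost: "sets (borel :: real measure) = sigma_sets UNIV (range (\<lambda>c. {..c}))"
  by (simp add: borel_eq_atMost sets_measure_of_conv)

lemma Int_stable_atMost: "Int_stable (range (\<lambda>c::real. {..c}))"
proof (rule Int_stableI_image)
  show "\<exists>k\<in>UNIV. {..i} \<inter> {..j} = {..k}" for i j :: real
    by (rule bexI[of _ "min i j"]) auto
qed

theorem spectral_measure_exists:
  fixes T :: "'a::complex_hilbert_space \<Rightarrow> 'a"
  assumes T: "selfadjoint T"
  obtains E where "is_spectral_measure E T"
    "\<And>c L x. subspace L \<Longrightarrow> closed L \<Longrightarrow> T ` L \<subseteq> L \<Longrightarrow> x \<in> L \<Longrightarrow> E {..c} x \<in> L"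
proof -
  obtain K where K: "K > 0" "\<And>x. norm (T x) \<le> K * norm x"
    using bounded_clinear_bound[OF selfadjointD(1)[OF T]] by blast
  define A where "A x = (1 / (2 * K)) *\<^sub>R (T x + K *\<^sub>R x)" for x
  have A: "selfadjoint A" unfolding A_def by (intro selfadjoint_scaleR selfadjoint_add T selfadjoint_id)
  have formA: "inner (A x) x = (inner (T x) x + K * (norm x)\<^sup>2) / (2 * K)" for x
    by (simp add: A_def inner_add_left power2_norm_eq_inner)
  have formT: "\<bar>inner (T x) x\<bar> \<le> K * (norm x)\<^sup>2" for x
    using Cauchy_Schwarz_ineq2[of "T x" x] mult_right_mono[OF K(2)[of x], of "norm x"] by (simp add: power2_eq_square)
  have A0: "inner (A x) x \<ge> 0" and A1: "inner (A x) x \<le> (norm x)\<^sup>2" for x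
    using formT[of x] K(1) by (auto simp: formA field_simps)
  have "\<exists>M. sets M = sets (borel :: real measure) \<and> finite_measure M \<and> (AE t in M. t \<in> {0..1}) \<and>
    (\<forall>k. (LINT t|M. t ^ k) = inner ((A ^^ k) x) x)" for x
    using contraction_moment_measure[OF A A0 A1] by metis
  then obtain M where M: "\<And>x. sets (M x) = sets (borel :: real measure)" "\<And>x. finite_measure (M x)"
    "\<And>x. AE t in M x. t \<in> {0..1}" "\<And>x k. (LINT t|M x. t ^ k) = inner ((A ^^ k) x) x"
    by metis
  note [measurable_cong] = M(1)
  have M_space: "space (M x) = UNIV" for x using sets_eq_imp_space_eq[OF M(1)[of x]] by simp
  define \<nu> where "\<nu> x = distr (M x) borel (\<lambda>t. 2 * K * t - K)" for x
  have \<nu>_fin: "finite_measure (\<nu> x)" for x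
    unfolding \<nu>_def by (intro finite_measure.finite_measure_distr M(2)) measurable
  have \<nu>_sets: "sets (\<nu> x) = sets borel" for x by (simp add: \<nu>_def)
  have \<nu>_UNIV: "measure (\<nu> x) UNIV = (norm x)\<^sup>2" for x
    using M(4)[of x 0] by (simp add: \<nu>_def measure_distr M_space power2_norm_eq_inner)
  have "measure (\<nu> x) {..c} = measure (M x) {..(c + K) / (2 * K)}" for x c
  proof -
    have "(\<lambda>t. 2 * K * t - K) -` {..c} = {..(c + K) / (2 * K)}"
      using K(1) by (auto simp: field_simps)
    then show ?thesis unfolding \<nu>_def by (subst measure_distr) (simp_all add: M_space)
  qed
  moreover have "A ` L \<subseteq> L" if "subspace L" "T ` L \<subseteq> L" for L
    unfolding A_def using that by (auto intro!: subspace_scale subspace_add)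
  ultimately have cutoff: "\<exists>P. orth_projection P \<and> (\<forall>x. inner (P x) x = measure (\<nu> x) {..c}) \<and>
    (\<forall>L x. subspace L \<longrightarrow> closed L \<longrightarrow> T ` L \<subseteq> L \<longrightarrow> x \<in> L \<longrightarrow> P x \<in> L)" for c
    using contraction_cutoff_projection[OF A M, of "(c + K) / (2 * K)"] by (metis (no_types, lifting))
  have "\<exists>P. orth_projection P \<and> (\<forall>x. inner (P x) x = measure (\<nu> x) S)" if "S \<in> sets borel" for S
    using Int_stable_atMost subset_Pow_Union[THEN subset_trans, OF Pow_mono[OF subset_UNIV]] that[unfolded sets_borel_eq_sigma_atMost]
  proof (induction rule: sigma_sets_induct_disjoint)
    case (basic S)
    then obtain c where S: "S = {..c}" by blast
    then show ?case using cutoff by metis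
  next
    case empty
    have "orth_projection (\<lambda>x::'a. 0)"
      by (rule orth_projectionI) (use selfadjoint_scaleR[OF selfadjoint_id, of 0] in simp_all)
    then show ?case by (intro exI[of _ "\<lambda>x. 0"]) simp
  next
    case (compl S)
    then obtain P where P: "orth_projection P" "\<And>x. inner (P x) x = measure (\<nu> x) S" by blast
    have S: "S \<in> sets borel" using compl(1) by (simp add: sets_borel_eq_sigma_atMost)
    have "inner (x - P x) x = measure (\<nu> x) (UNIV - S)" for x
      using finite_measure.finite_measure_Diff[OF \<nu>_fin[of x], of UNIV S] S
      by (simp add: inner_diff_left P(2) \<nu>_UNIV power2_norm_eq_inner \<nu>_sets)
    then show ?case using orth_projection_complement[OF P(1)] by blast
  next
    case (union F)
    then obtain P where P: "\<And>i. orth_projection (P i)" "\<And>i x. inner (P i x) x = measure (\<nu> x) (F i)" by metis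
    have F: "range F \<subseteq> sets borel" using union(2) by (auto simp: sets_borel_eq_sigma_atMost)
    have q: "(\<lambda>i. inner (P i x) x) sums measure (\<nu> x) (\<Union>i. F i)" for x
      unfolding P(2) using finite_measure.finite_measure_UNION[OF \<nu>_fin, of F] F union(1) by (simp add: \<nu>_sets)
    have le: "measure (\<nu> x) (\<Union>i. F i) \<le> (norm x)\<^sup>2" for x
      unfolding \<nu>_UNIV[symmetric] by (intro finite_measure.finite_measure_mono[OF \<nu>_fin]) (auto simp: \<nu>_sets)
    obtain R where "orth_projection R" "\<And>x. inner (R x) x = measure (\<nu> x) (\<Union>i. F i)"
      by (rule orth_projection_sum[OF P(1) q le], rule that)
    then show ?case by blast
  qed
  then obtain E where E: "\<And>S. S \<in> sets borel \<Longrightarrow> orth_projection (E S)"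
    and formE: "\<And>S x. S \<in> sets borel \<Longrightarrow> inner (E S x) x = measure (\<nu> x) S"
    by metis
  have "projection_valued_measure E"
    unfolding projection_valued_measure_def
  proof (intro conjI ballI allI impI E)
    have "orth_projection (id :: 'a \<Rightarrow> 'a)"
      using selfadjoint_id by (intro orth_projectionI) (simp_all add: id_def)
    then show "E UNIV = id"
      by (intro orth_projection_eqI E) (simp_all add: formE \<nu>_UNIV power2_norm_eq_inner)
  next
    fix F :: "nat \<Rightarrow> real set" and x
    assume F: "range F \<subseteq> sets borel" "disjoint_family F"
    have Fi: "F i \<in> sets borel" for i using F(1) by blast
    have U: "(\<Union>i. F i) \<in> sets borel" using Fi by blast
    have q: "(\<lambda>i. inner (E (F i) x) x) sums measure (\<nu> x) (\<Union>i. F i)" for x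
      unfolding formE[OF Fi] using finite_measure.finite_measure_UNION[OF \<nu>_fin, of F] F by (simp add: \<nu>_sets)
    have le: "measure (\<nu> x) (\<Union>i. F i) \<le> (norm x)\<^sup>2" for x
      unfolding \<nu>_UNIV[symmetric] by (intro finite_measure.finite_measure_mono[OF \<nu>_fin]) (auto simp: \<nu>_sets)
    obtain R where R: "orth_projection R" "\<And>x. (\<lambda>i. E (F i) x) sums R x"
        "\<And>x. inner (R x) x = measure (\<nu> x) (\<Union>i. F i)"
      by (rule orth_projection_sum[OF E[OF Fi] q le], rule that)
    have "R = E (\<Union>i. F i)"
      by (rule orth_projection_eqI[OF R(1) E[OF U]]) (simp add: R(3) formE[OF U])
    then show "(\<lambda>n. E (F n) x) sums E (\<Union>n. F n) x" using R(2) by simp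
  qed
  moreover have "has_bochner_integral (scalar_measure E x) complex_of_real (cinner (T x) x)" for x
  proof -
    have "scalar_measure E x = measure_of (space (\<nu> x)) (sets (\<nu> x)) (emeasure (\<nu> x))"
      unfolding scalar_measure_def
    proof (subst measure_of_eq[where \<mu>' = "emeasure (\<nu> x)"])
      show "ennreal (Re (cinner (E S x) x)) = emeasure (\<nu> x) S" if "S \<in> sigma_sets UNIV (sets borel)" for S
      proof -
        have "S \<in> sets borel" using that sets.sigma_sets_eq[of "borel :: real measure"] by simp
        then show ?thesis
          by (simp add: Re_cinner formE finite_measure.emeasure_eq_measure[OF \<nu>_fin])
      qed
    qed (simp_all add: \<nu>_def)
    then have sm: "scalar_measure E x = \<nu> x" by (simp add: measure_of_of_measure)
    have ib: "integrable (M x) (\<lambda>t. t)"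
      using M(3)[of x] by (intro finite_measure.integrable_const_bound[OF M(2), where B = 1]) auto
    have c: "integrable (M x) (\<lambda>t. K)" by (rule finite_measure.integrable_const[OF M(2)])
    have "has_bochner_integral (M x) (\<lambda>t. 2 * K * t - K) (2 * K * (LINT t|M x. t) - (LINT t|M x. K))"
      using ib c by (intro has_bochner_integral_diff has_bochner_integral_mult_right has_bochner_integral_integrable)
    also have "2 * K * (LINT t|M x. t) - (LINT t|M x. K) = inner (T x) x"
      using M(4)[of x 1] M(4)[of x 0] K(1) by (simp add: formA M_space power2_norm_eq_inner)
    finally have "has_bochner_integral (\<nu> x) (\<lambda>t. t) (inner (T x) x)"
      unfolding \<nu>_def by (intro has_bochner_integral_distr) auto
    then show ?thesis
      unfolding sm selfadjoint_cinner_self[OF T]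
      by (intro has_bochner_integral_of_real)
  qed
  moreover have "E {..c} x \<in> L" if L: "subspace L" "closed L" "T ` L \<subseteq> L" "x \<in> L" for c L x
  proof -
    obtain P where P: "orth_projection P" "\<And>x. inner (P x) x = measure (\<nu> x) {..c}" "P x \<in> L"
      using cutoff[of c] L by blast
    have "P = E {..c}" by (rule orth_projection_eqI[OF P(1) E]) (simp_all add: P(2) formE)
    then show ?thesis using P(3) by simp
  qed
  ultimately show thesis using that unfolding is_spectral_measure_def by blast
qed

lemma spectral_projection_is_spectral_measure:
  fixes T :: "'a::complex_hilbert_space \<Rightarrow> 'a"
  assumes "selfadjoint T" shows "is_spectral_measure (spectral_projection T) T"
proof -
  have "\<exists>E. is_spectral_measure E T" by (rule spectral_measure_exists[OF assms]) blast
  then show ?thesis unfolding spectral_projection_def by (rule someI_ex)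
qed

section \<open>Calculus of a spectral measure\<close>

locale spectral_measure =
  fixes E :: "real set \<Rightarrow> 'a::complex_hilbert_space \<Rightarrow> 'a" and T :: "'a \<Rightarrow> 'a"
  assumes selfadjoint: "selfadjoint T" and spectral: "is_spectral_measure E T"
begin

lemma proj: "A \<in> sets borel \<Longrightarrow> orth_projection (E A)"
  and E_UNIV: "E UNIV x = x"
  and E_sums: "range F \<subseteq> sets borel \<Longrightarrow> disjoint_family F \<Longrightarrow> (\<lambda>n. E (F n) x) sums E (\<Union>n. F n) x"
  and has_integral_T: "has_bochner_integral (scalar_measure E x) complex_of_real (cinner (T x) x)"
  using spectral unfolding is_spectral_measure_def projection_valued_measure_def by auto

lemmas lin_T = selfadjoint_simps[OF selfadjoint]

lemma lin_E:
  assumes "A \<in> sets borel"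
  shows "E A (x + y) = E A x + E A y" "E A (x - y) = E A x - E A y" "E A 0 = 0" "E A (c *\<^sub>C x) = c *\<^sub>C E A x"
    "E A (r *\<^sub>R x) = r *\<^sub>R E A x"
  using selfadjoint_simps[OF orth_projectionD(1)[OF proj[OF assms]]] by auto

lemma E_empty: "E {} x = 0"
proof -
  have "(\<lambda>n::nat. E {} x) sums E (\<Union>n::nat. {}) x"
    by (rule E_sums) (auto simp: disjoint_family_on_def)
  then have "(\<lambda>n::nat. E {} x) \<longlonglongrightarrow> 0"
    using sums_summable summable_LIMSEQ_zero by blast
  then show ?thesis by (simp add: LIMSEQ_const_iff)
qed

lemma E_Un:
  assumes A: "A \<in> sets borel" and B: "B \<in> sets borel" and "A \<inter> B = {}"
  shows "E (A \<union> B) x = E A x + E B x"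
proof -
  have "(\<lambda>n. E (binaryset A B n) x) sums E (\<Union>n. binaryset A B n) x"
    using assms by (intro E_sums) (auto simp: range_binaryset_eq disjoint_family_on_def binaryset_def)
  moreover have "(\<lambda>n. E (binaryset A B n) x) sums (\<Sum>n\<in>{0, 1}. E (binaryset A B n) x)"
    by (rule sums_finite) (auto simp: binaryset_def E_empty)
  ultimately show ?thesis
    using sums_unique2 by (fastforce simp: UN_binaryset_eq binaryset_def)
qed

lemma E_disjoint:
  assumes A: "A \<in> sets borel" and B: "B \<in> sets borel" and "A \<inter> B = {}"
  shows "E A (E B x) = 0"
proof -
  let ?y = "E B x"
  have AB: "A \<union> B \<in> sets borel" using A B by blast
  have "inner (E A ?y) ?y + inner (E B ?y) ?y = inner (E (A \<union> B) ?y) ?y"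
    by (simp add: E_Un[OF assms] inner_add_left)
  also have "\<dots> \<le> (norm ?y)\<^sup>2"
    using orth_projection_norm_le[OF proj[OF AB], of ?y]
    by (simp add: orth_projectionD(3)[OF proj[OF AB]] power_mono)
  finally have "(norm (E A ?y))\<^sup>2 \<le> 0"
    by (simp add: power2_norm_eq_inner[of ?y] orth_projectionD(2,3)[OF proj[OF A]] orth_projectionD(2,3)[OF proj[OF B]])
  then show ?thesis by simp
qed

lemma E_Int:
  assumes A: "A \<in> sets borel" and B: "B \<in> sets borel"
  shows "E A (E B x) = E (A \<inter> B) x"
proof -
  have AB: "A \<inter> B \<in> sets borel" "A - B \<in> sets borel" "B - A \<in> sets borel" using A B by auto
  have disj: "(A \<inter> B) \<inter> (B - A) = {}" by blast
  have "E A (E B x) = E ((A \<inter> B) \<union> (A - B)) (E B x)"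
    by (simp add: Int_Diff_Un)
  also have "\<dots> = E (A \<inter> B) (E B x)"
    using E_Un[OF AB(1,2)] E_disjoint[OF AB(2) B] by force
  also have "\<dots> = E (A \<inter> B) (E ((A \<inter> B) \<union> (B - A)) x)"
    by (metis Int_Diff_Un Int_commute)
  also have "\<dots> = E (A \<inter> B) (E (A \<inter> B) x) + E (A \<inter> B) (E (B - A) x)"
    using E_Un[OF AB(1,3), of x] by (subst E_Un) (auto simp: AB lin_E)
  also have "\<dots> = E (A \<inter> B) x"
    using E_disjoint[OF AB(1,3) disj, of x] by (simp add: orth_projectionD(2)[OF proj[OF AB(1)]] Int_Diff)
  finally show ?thesis .
qed

lemma E_compl:
  assumes "A \<in> sets borel" shows "E (- A) x = x - E A x"
  using E_Un[of A "- A" x] assms E_UNIV[of x] by (simp add: Compl_partition algebra_simps)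

lemma E_mono:
  assumes "A \<in> sets borel" "B \<in> sets borel" "A \<subseteq> B" "E A x = x" shows "E B x = x"
  using E_Int[of B A x] assms by (simp add: inf.absorb2)

lemma E_null_mono:
  assumes "A \<in> sets borel" "B \<in> sets borel" "A \<subseteq> B" "E B x = 0" shows "E A x = 0"
  using E_Int[of A B x] assms by (simp add: inf.absorb1 lin_E)

lemma cinner_E: "A \<in> sets borel \<Longrightarrow> cinner (E A x) y = cinner x (E A y)"
  by (rule selfadjointD(2)[OF orth_projectionD(1)[OF proj]])

lemma inner_E: "A \<in> sets borel \<Longrightarrow> inner (E A x) y = inner x (E A y)"
  by (rule selfadjointD(3)[OF orth_projectionD(1)[OF proj]])

lemma sets_scalar_measure [simp, measurable_cong]: "sets (scalar_measure E x) = sets borel"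
  using sets.sigma_sets_eq[of "borel :: real measure"] by (simp add: scalar_measure_def)

lemma space_scalar_measure [simp]: "space (scalar_measure E x) = UNIV"
  by (simp add: scalar_measure_def)

lemma emeasure_scalar_measure:
  assumes "A \<in> sets borel" shows "emeasure (scalar_measure E x) A = ennreal ((norm (E A x))\<^sup>2)"
proof -
  have form: "Re (cinner (E A x) x) = (norm (E A x))\<^sup>2" if "A \<in> sets borel" for A
    using that by (simp add: Re_cinner orth_projectionD(3)[OF proj])
  have "emeasure (scalar_measure E x) A = ennreal (Re (cinner (E A x) x))"
    unfolding scalar_measure_def
  proof (rule emeasure_measure_of_sigma)
    show "sigma_algebra UNIV (sets (borel :: real measure))"
      using sets.sigma_algebra_axioms[of "borel :: real measure"] by simp
    show "positive (sets borel) (\<lambda>A. ennreal (Re (cinner (E A x) x)))"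
      by (simp add: positive_def E_empty)
    show "countably_additive (sets borel) (\<lambda>A. ennreal (Re (cinner (E A x) x)))"
    proof (rule countably_additiveI)
      fix F :: "nat \<Rightarrow> real set"
      assume F: "range F \<subseteq> sets borel" "disjoint_family F" "(\<Union>n. F n) \<in> sets borel"
      have Fi: "F i \<in> sets borel" for i using F(1) by blast
      have "(\<lambda>n. Re (cinner (E (F n) x) x)) sums Re (cinner (E (\<Union>n. F n) x) x)"
        unfolding Re_cinner by (rule bounded_linear.sums[OF bounded_linear_inner_left E_sums[OF F(1,2)]])
      then have "(\<lambda>n. ennreal (Re (cinner (E (F n) x) x))) sums ennreal (Re (cinner (E (\<Union>n. F n) x) x))"
        by (subst sums_ennreal) (simp_all add: form Fi F(3))
      then show "(\<Sum>n. ennreal (Re (cinner (E (F n) x) x))) = ennreal (Re (cinner (E (\<Union>n. F n) x) x))"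
        by (rule sums_unique[symmetric])
    qed
  qed (fact assms)
  then show ?thesis using form[OF assms] by simp
qed

lemma measure_scalar_measure_UNIV: "measure (scalar_measure E x) UNIV = (norm x)\<^sup>2"
  using emeasure_scalar_measure[of UNIV x] by (simp add: measure_def E_UNIV)

lemma finite_scalar_measure: "finite_measure (scalar_measure E x)"
  by (rule finite_measureI) (simp add: emeasure_scalar_measure)

lemma has_integral_form: "has_bochner_integral (scalar_measure E x) (\<lambda>t. t) (inner (T x) x)"
  using has_bochner_integral_bounded_linear[OF bounded_linear_Re has_integral_T[of x]] by (simp add: Re_cinner)

lemma scalar_measure_restrict:
  assumes A: "A \<in> sets borel"
  shows "scalar_measure E (E A x) = density (scalar_measure E x) (indicator A)"
proof (rule measure_eqI)
  fix B assume "B \<in> sets (scalar_measure E (E A x))"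
  then have B: "B \<in> sets borel" by simp
  then show "emeasure (scalar_measure E (E A x)) B = emeasure (density (scalar_measure E x) (indicator A)) B"
    using A by (simp add: emeasure_density emeasure_scalar_measure E_Int Int_commute
        nn_integral_indicator flip: indicator_inter_arith)
qed simp

lemma form_split:
  assumes A: "A \<in> sets borel"
  shows "inner (T x) x = inner (T (E A x)) (E A x) + inner (T (E (- A) x)) (E (- A) x)"
proof -
  let ?M = "scalar_measure E x"
  have i: "integrable ?M (\<lambda>t. t)" using has_integral_form by (rule integrable.intros)
  have f: "inner (T x) x = (LINT t|scalar_measure E x. t)" for x
    using has_bochner_integral_integral_eq[OF has_integral_form[of x]] by simp
  have r: "inner (T (E B x)) (E B x) = (LINT t|?M. indicator B t * t)" if B: "B \<in> sets borel" for B
  proof -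
    have "(LINT t|density ?M (indicator B). t) = (LINT t|density ?M (\<lambda>t. ennreal (indicator B t)). t)"
      by (simp add: ennreal_indicator)
    also have "\<dots> = (LINT t|?M. indicator B t * t)"
      using B by (subst integral_density) auto
    finally show ?thesis unfolding f scalar_measure_restrict[OF B] .
  qed
  have i': "integrable ?M (\<lambda>t. indicator B t * t)" if "B \<in> sets borel" for B
    using integrable_real_mult_indicator[OF _ i, of B] that by (simp add: mult.commute)
  have "inner (T x) x = (LINT t|?M. indicator A t * t + indicator (- A) t * t)"
    unfolding f by (intro Bochner_Integration.integral_cong) (auto simp: indicator_def)
  also have "\<dots> = (LINT t|?M. indicator A t * t) + (LINT t|?M. indicator (- A) t * t)"
    using A by (intro Bochner_Integration.integral_add i') auto
  finally show ?thesis using A by (simp add: r)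
qed

lemma T_orthogonal:
  assumes A: "A \<in> sets borel" shows "inner (T (E A x)) (E (- A) y) = 0"
proof -
  define z where "z = E A x + E (- A) y"
  have mA: "- A \<in> sets borel" using A by auto
  have z: "E A z = E A x" "E (- A) z = E (- A) y"
    unfolding z_def using E_disjoint[OF A mA] E_disjoint[OF mA A]
    by (auto simp: lin_E[OF A] lin_E[OF mA] orth_projectionD(2)[OF proj[OF A]] orth_projectionD(2)[OF proj[OF mA]])
  have "inner (T z) z = inner (T (E A x)) (E A x) + inner (T (E (- A) y)) (E (- A) y)"
    using form_split[OF A, of z] by (simp only: z)
  moreover have "inner (T z) z = inner (T (E A x)) (E A x) + inner (T (E (- A) y)) (E (- A) y) + 2 * inner (T (E A x)) (E (- A) y)"
    unfolding z_def using selfadjointD(3)[OF selfadjoint, of "E (- A) y" "E A x"]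
    by (simp add: lin_T inner_add inner_commute)
  ultimately show ?thesis by simp
qed

lemma E_commute:
  assumes A: "A \<in> sets borel" shows "E A (T x) = T (E A x)"
proof -
  have mA: "- A \<in> sets borel" using A by auto
  have inv: "E B (T (E B x)) = T (E B x)" if B: "B \<in> sets borel" for B x
  proof -
    have mB: "- B \<in> sets borel" using B by auto
    let ?u = "T (E B x)"
    have "inner (E (- B) ?u) (E (- B) ?u) = inner ?u (E (- B) (E (- B) ?u))"
      by (rule inner_E[OF mB])
    also have "\<dots> = 0" by (rule T_orthogonal[OF B])
    finally have "E (- B) ?u = 0" by simp
    then show ?thesis by (simp add: E_compl[OF B])
  qed
  have "E A (T (E (- A) x)) = 0"
    using inv[OF mA, of x] E_disjoint[OF A mA, of "T (E (- A) x)"] by simp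
  moreover have "T x = T (E A x) + T (E (- A) x)" by (simp add: E_compl[OF A] lin_T)
  ultimately show ?thesis using inv[OF A, of x] by (simp add: lin_E[OF A])
qed

lemma AE_scalar_measure:
  assumes A: "A \<in> sets borel" and x: "E A x = x" shows "AE t in scalar_measure E x. t \<in> A"
proof (rule AE_I[where N = "- A"])
  have "E (- A) x = 0" using x E_compl[OF A, of x] by simp
  then show "emeasure (scalar_measure E x) (- A) = 0"
    using A emeasure_scalar_measure[of "- A" x] by simp
qed (use A in auto)

lemma form_le:
  assumes A: "A \<in> sets borel" "A \<subseteq> {..b}" and x: "E A x = x"
  shows "inner (T x) x \<le> b * (norm x)\<^sup>2"
proof -
  let ?M = "scalar_measure E x"
  have "inner (T x) x = (LINT t|?M. t)" using has_bochner_integral_integral_eq[OF has_integral_form] by simp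
  also have "\<dots> \<le> (LINT t|?M. b)"
    using AE_scalar_measure[OF A(1) x] A(2)
    by (intro integral_mono_AE integrable.intros[OF has_integral_form]
      finite_measure.integrable_const[OF finite_scalar_measure]) auto
  finally show ?thesis by (simp add: measure_scalar_measure_UNIV mult.commute)
qed

lemma form_ge:
  assumes A: "A \<in> sets borel" "A \<subseteq> {a..}" and x: "E A x = x"
  shows "a * (norm x)\<^sup>2 \<le> inner (T x) x"
proof -
  let ?M = "scalar_measure E x"
  have "(LINT t|?M. a) \<le> (LINT t|?M. t)"
    using AE_scalar_measure[OF A(1) x] A(2)
    by (intro integral_mono_AE integrable.intros[OF has_integral_form]
      finite_measure.integrable_const[OF finite_scalar_measure]) auto
  also have "\<dots> = inner (T x) x" using has_bochner_integral_integral_eq[OF has_integral_form] by simp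
  finally show ?thesis by (simp add: measure_scalar_measure_UNIV mult.commute)
qed

lemma E_shift_commute:
  assumes "A \<in> sets borel" shows "E A (T x - s *\<^sub>R x) = T (E A x) - s *\<^sub>R E A x"
  using assms by (simp add: lin_E E_commute)

lemma norm_shift_le:
  assumes A: "A \<in> sets borel" "A \<subseteq> {s - r..s + r}" and x: "E A x = x" and r: "r \<ge> 0"
  shows "norm (T x - s *\<^sub>R x) \<le> r * norm x"
proof (rule selfadjoint_form_bound[OF selfadjoint_shift[OF selfadjoint] r, where V = "{x. E A x = x}"])
  fix x assume "x \<in> {x. E A x = x}"
  then have x: "E A x = x" by simp
  have "inner (T x) x \<le> (s + r) * (norm x)\<^sup>2" "(s - r) * (norm x)\<^sup>2 \<le> inner (T x) x"
    using A by (auto intro!: form_le[OF A(1) _ x] form_ge[OF A(1) _ x])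
  then show "\<bar>inner (T x - s *\<^sub>R x) x\<bar> \<le> r * (norm x)\<^sup>2"
    by (simp add: inner_diff_left power2_norm_eq_inner[symmetric] algebra_simps abs_le_iff)
qed (use A(1) x in \<open>auto simp: lin_E E_shift_commute E_commute\<close>)

lemma norm_shift_split:
  assumes A: "A \<in> sets borel"
  shows "(norm (T x - s *\<^sub>R x))\<^sup>2 = (norm (T (E A x) - s *\<^sub>R E A x))\<^sup>2 + (norm (T (E (- A) x) - s *\<^sub>R E (- A) x))\<^sup>2"
  using orth_projection_norm[OF proj[OF A], of "T x - s *\<^sub>R x"] A E_compl[OF A, of "T x - s *\<^sub>R x"]
    E_shift_commute[of "- A" x s] by (simp add: E_shift_commute)

lemma norm_shift_ge_left:
  assumes A: "A \<in> sets borel" "A \<subseteq> {..s - r}" and x: "E A x = x"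
  shows "r * norm x \<le> norm (T x - s *\<^sub>R x)"
proof (cases "x = 0")
  case False
  have "r * (norm x)\<^sup>2 \<le> inner (s *\<^sub>R x - T x) x"
    using form_le[OF A x] by (simp add: inner_diff_left power2_norm_eq_inner[symmetric] algebra_simps)
  also have "\<dots> \<le> norm (s *\<^sub>R x - T x) * norm x" by (rule norm_cauchy_schwarz)
  finally show ?thesis using False by (simp add: power2_eq_square norm_minus_commute)
qed simp

lemma norm_shift_ge_right:
  assumes A: "A \<in> sets borel" "A \<subseteq> {s + r..}" and x: "E A x = x"
  shows "r * norm x \<le> norm (T x - s *\<^sub>R x)"
proof (cases "x = 0")
  case False
  have "r * (norm x)\<^sup>2 \<le> inner (T x - s *\<^sub>R x) x"
    using form_ge[OF A x] by (simp add: inner_diff_left power2_norm_eq_inner[symmetric] algebra_simps)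
  also have "\<dots> \<le> norm (T x - s *\<^sub>R x) * norm x" by (rule norm_cauchy_schwarz)
  finally show ?thesis using False by (simp add: power2_eq_square)
qed simp

lemma norm_shift_ge:
  assumes A: "A \<in> sets borel" "A \<inter> {s - r<..<s + r} = {}" and x: "E A x = x" and r: "r \<ge> 0"
  shows "r * norm x \<le> norm (T x - s *\<^sub>R x)"
proof (rule power2_le_imp_le)
  let ?B = "{..s - r}"
  have xl: "E (A \<inter> ?B) (E ?B x) = E ?B x" and xr: "E (A \<inter> - ?B) (E (- ?B) x) = E (- ?B) x"
    using A(1) x E_Int[of ?B A x] E_Int[of "- ?B" A x] by (auto simp: E_Int Int_ac)
  have "(r * norm x)\<^sup>2 = (r * norm (E ?B x))\<^sup>2 + (r * norm (E (- ?B) x))\<^sup>2"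
    using orth_projection_norm[OF proj, of ?B x] E_compl[of ?B x] by (simp add: power_mult_distrib distrib_left)
  also have "\<dots> \<le> (norm (T (E ?B x) - s *\<^sub>R E ?B x))\<^sup>2 + (norm (T (E (- ?B) x) - s *\<^sub>R E (- ?B) x))\<^sup>2"
    using A r by (intro add_mono power_mono norm_shift_ge_left[OF _ _ xl] norm_shift_ge_right[OF _ _ xr])
      (auto simp: not_le)
  also have "\<dots> = (norm (T x - s *\<^sub>R x))\<^sup>2"
    using norm_shift_split[of ?B x s] by simp
  finally show "(r * norm x)\<^sup>2 \<le> (norm (T x - s *\<^sub>R x))\<^sup>2" .
qed simp

lemma E_null_iff:
  assumes "A \<in> sets borel" shows "E A x = 0 \<longleftrightarrow> A \<in> null_sets (scalar_measure E x)"
  using assms emeasure_scalar_measure[OF assms, of x] by (auto simp: null_sets_def)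

lemma E_null_UN:
  assumes "countable I" "\<And>i. i \<in> I \<Longrightarrow> A i \<in> sets borel" "\<And>i. i \<in> I \<Longrightarrow> E (A i) x = 0"
  shows "E (\<Union>i\<in>I. A i) x = 0"
  using assms by (subst E_null_iff) (auto simp: E_null_iff intro!: null_sets_UN')

lemma E_null_local:
  assumes U: "U \<in> sets borel" and loc: "\<And>s. s \<in> U \<Longrightarrow> \<exists>e>0. E {s - e<..<s + e} x = 0"
  shows "E U x = 0"
proof -
  have "\<forall>s\<in>U. \<exists>e. e > 0 \<and> E {s - e<..<s + e} x = 0" using loc by blast
  from bchoice[OF this] obtain e where e: "\<forall>s\<in>U. e s > 0 \<and> E {s - e s<..<s + e s} x = 0" ..
  let ?F = "(\<lambda>s. {s - e s<..<s + e s}) ` U"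
  obtain F where F: "F \<subseteq> ?F" "countable F" "\<Union>F = \<Union>?F"
    by (rule Lindelof[of ?F]) auto
  have "E (\<Union>I\<in>F. I) x = 0"
  proof (rule E_null_UN[OF F(2)])
    fix I assume "I \<in> F"
    then obtain s where "s \<in> U" "I = {s - e s<..<s + e s}" using F(1) by blast
    then show "I \<in> sets borel" "E I x = 0" using e by auto
  qed
  moreover have "U \<subseteq> \<Union>F"
  proof
    fix s assume "s \<in> U"
    then show "s \<in> \<Union>F" unfolding F(3) using e by (intro UnionI[of "{s - e s<..<s + e s}"]) auto
  qed
  moreover have "\<Union>F \<in> sets borel" using F(1,2) by (intro sets.countable_Union) auto
  ultimately show ?thesis using U E_null_mono[of U "\<Union>F" x] by simp
qed

lemma E_atMost_unique:
  assumes F: "spectral_measure F T"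
    and inv: "\<And>c L x. subspace L \<Longrightarrow> closed L \<Longrightarrow> T ` L \<subseteq> L \<Longrightarrow> x \<in> L \<Longrightarrow> F {..c} x \<in> L"
  shows "E {..a} x = F {..a} x"
proof -
  interpret F: spectral_measure F T by (rule F)
  have range: "subspace {x. E A x = x}" "closed {x. E A x = x}" "T ` {x. E A x = x} \<subseteq> {x. E A x = x}"
    if A: "A \<in> sets borel" for A
  proof -
    show "subspace {x. E A x = x}" using A by (auto simp: subspace_def lin_E)
    have "continuous_on UNIV (E A)"
      by (intro linear_continuous_on bounded_clinearD(1)[OF selfadjointD(1)[OF orth_projectionD(1)[OF proj[OF A]]]])
    then show "closed {x. E A x = x}" by (intro closed_Collect_eq continuous_on_id)
    show "T ` {x. E A x = x} \<subseteq> {x. E A x = x}" using A by (auto simp: E_commute)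
  qed
  have comm: "E A (F {..c} x) = F {..c} (E A x)" if A: "A \<in> sets borel" for A c x
  proof -
    have mA: "- A \<in> sets borel" using A by auto
    have 1: "E A (F {..c} (E A x)) = F {..c} (E A x)"
      using inv[OF range[OF A], of "E A x" c] orth_projectionD(2)[OF proj[OF A]] by simp
    have "E (- A) (F {..c} (E (- A) x)) = F {..c} (E (- A) x)"
      using inv[OF range[OF mA], of "E (- A) x" c] orth_projectionD(2)[OF proj[OF mA]] by simp
    then have 2: "E A (F {..c} (E (- A) x)) = 0"
      using E_disjoint[OF A mA, of "F {..c} (E (- A) x)"] by simp
    have "F {..c} x = F {..c} (E A x) + F {..c} (E (- A) x)"
      by (simp add: E_compl[OF A] F.lin_E)
    then show ?thesis using 1 2 by (simp add: lin_E[OF A])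
  qed
  have comm': "E A (F {c<..} x) = F {c<..} (E A x)" if A: "A \<in> sets borel" for A c x
    using F.E_compl[of "{..c}"] comm[OF A] lin_E[OF A] by (metis Compl_atMost atMost_borel)
  have ge: "{a<..} = (\<Union>n::nat. {a + 1 / real (Suc n)<..})" for a :: real
  proof (intro set_eqI iffI)
    fix t assume "t \<in> {a<..}"
    then obtain n where "1 / real (Suc n) < t - a"
      using reals_Archimedean[of "t - a"] by (auto simp: inverse_eq_divide)
    then show "t \<in> (\<Union>n::nat. {a + 1 / real (Suc n)<..})" by (auto intro!: exI[of _ n])
  next
    fix t assume "t \<in> (\<Union>n::nat. {a + 1 / real (Suc n)<..})"
    then obtain n where "a + 1 / real (Suc n) < t" by auto
    moreover have "0 < 1 / real (Suc n)" by simp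
    ultimately show "t \<in> {a<..}" unfolding greaterThan_iff by linarith
  qed
  have sep: "z = 0" if "inner (T z) z \<le> a * (norm z)\<^sup>2" "b * (norm z)\<^sup>2 \<le> inner (T z) z" "a < b" for a b z
  proof -
    have "b * (norm z)\<^sup>2 \<le> a * (norm z)\<^sup>2" using that by linarith
    then have "(norm z)\<^sup>2 \<le> 0"
      using that(3) by (metis mult_le_cancel_right not_less zero_le_power2 order.antisym order_refl)
    then show ?thesis by simp
  qed
  have 1: "F {a<..} (E {..a} x) = 0" for x
  proof (subst ge, rule F.E_null_UN)
    fix n :: nat
    let ?b = "a + 1 / real (Suc n)"
    show "F {?b<..} (E {..a} x) = 0"
    proof (rule sep[of _ a ?b])
      have "E {..a} (F {?b<..} (E {..a} x)) = F {?b<..} (E {..a} x)"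
        by (simp add: comm' orth_projectionD(2)[OF proj])
      then show "inner (T (F {?b<..} (E {..a} x))) (F {?b<..} (E {..a} x)) \<le> a * (norm (F {?b<..} (E {..a} x)))\<^sup>2"
        by (intro form_le[of "{..a}"]) auto
      show "?b * (norm (F {?b<..} (E {..a} x)))\<^sup>2 \<le> inner (T (F {?b<..} (E {..a} x))) (F {?b<..} (E {..a} x))"
        by (intro F.form_ge[of "{?b<..}"]) (auto simp: orth_projectionD(2)[OF F.proj])
    qed simp
  qed auto
  have 2: "E {a<..} (F {..a} x) = 0" for x
  proof (subst ge, rule E_null_UN)
    fix n :: nat
    let ?b = "a + 1 / real (Suc n)"
    show "E {?b<..} (F {..a} x) = 0"
    proof (rule sep[of _ a ?b])
      have "F {..a} (E {?b<..} (F {..a} x)) = E {?b<..} (F {..a} x)"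
        by (simp add: comm[symmetric] orth_projectionD(2)[OF F.proj])
      then show "inner (T (E {?b<..} (F {..a} x))) (E {?b<..} (F {..a} x)) \<le> a * (norm (E {?b<..} (F {..a} x)))\<^sup>2"
        by (intro F.form_le[of "{..a}"]) auto
      show "?b * (norm (E {?b<..} (F {..a} x)))\<^sup>2 \<le> inner (T (E {?b<..} (F {..a} x))) (E {?b<..} (F {..a} x))"
        by (intro form_ge[of "{?b<..}"]) (auto simp: orth_projectionD(2)[OF proj])
    qed simp
  qed auto
  have "F {..a} (E {..a} x) = E {..a} x"
    using 1[of x] F.E_compl[of "{..a}" "E {..a} x"] by simp
  moreover have "E {..a} (F {..a} x) = F {..a} x"
    using 2[of x] E_compl[of "{..a}" "F {..a} x"] by simp
  ultimately show ?thesis using comm[of "{..a}" a x] by simp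
qed

lemma E_invariant_subspace:
  assumes L: "subspace L" "closed L" "T ` L \<subseteq> L" "x \<in> L" and A: "A \<in> sets borel"
  shows "E A x \<in> L"
proof -
  obtain F where F: "is_spectral_measure F T"
    "\<And>c L x. subspace L \<Longrightarrow> closed L \<Longrightarrow> T ` L \<subseteq> L \<Longrightarrow> x \<in> L \<Longrightarrow> F {..c} x \<in> L"
    by (rule spectral_measure_exists[OF selfadjoint], rule that)
  have cut: "E {..c} x \<in> L" for c
    using E_atMost_unique[of F c x] F L selfadjoint by (simp add: spectral_measure_def)
  have sub_Pow: "range (\<lambda>c::real. {..c}) \<subseteq> Pow UNIV" by simp
  show ?thesis
    using Int_stable_atMost sub_Pow A[unfolded sets_borel_eq_sigma_atMost]
  proof (induction rule: sigma_sets_induct_disjoint)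
    case (basic A)
    then show ?case using cut by auto
  next
    case empty
    show ?case using L(1) by (simp add: E_empty subspace_0)
  next
    case (compl A)
    then show ?case
      using E_compl[of A x] L by (simp add: sets_borel_eq_sigma_atMost[symmetric] Compl_eq_Diff_UNIV subspace_diff)
  next
    case (union F)
    have "(\<lambda>n. E (F n) x) sums E (\<Union>n. F n) x"
      using union by (intro E_sums) (auto simp: sets_borel_eq_sigma_atMost)
    then have lim: "(\<lambda>n. \<Sum>i<n. E (F i) x) \<longlonglongrightarrow> E (\<Union>n. F n) x" by (simp only: sums_def)
    have "(\<Sum>i<n. E (F i) x) \<in> L" for n
      using union(3) L(1) by (intro subspace_sum) auto
    then show ?case by (rule closed_sequentially[OF L(2) _ lim])
  qed
qed

end

section \<open>Invertibility and the spectrum\<close>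

lemma coercive_surj:
  fixes A :: "'a::complex_hilbert_space \<Rightarrow> 'a"
  assumes A: "bounded_clinear A" and c: "c > 0" and co: "\<And>x. c * (norm x)\<^sup>2 \<le> inner (A x) x"
  shows "\<exists>x. A x = y"
proof -
  obtain K where K: "K > 0" "\<And>x. norm (A x) \<le> K * norm x" using bounded_clinear_bound[OF A] by blast
  define C where "C = K + c"
  have C: "C > 0" "c < C" "\<And>x. norm (A x) \<le> C * norm x"
  proof -
    show "norm (A x) \<le> C * norm x" for x
      using K(2)[of x] mult_nonneg_nonneg[OF less_imp_le[OF c] norm_ge_zero[of x]] unfolding C_def distrib_right by linarith
  qed (use K(1) c in \<open>auto simp: C_def\<close>)
  define t where "t = c / C\<^sup>2"
  define q where "q = sqrt (1 - c\<^sup>2 / C\<^sup>2)"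
  have cC: "c\<^sup>2 / C\<^sup>2 < 1" "0 < c\<^sup>2 / C\<^sup>2" using c C by (auto simp: power_strict_mono)
  have q: "0 \<le> q" "q < 1" "q\<^sup>2 = 1 - c\<^sup>2 / C\<^sup>2" using cC unfolding q_def by (auto simp: real_sqrt_lt_1_iff)
  have t: "t \<ge> 0" using c by (simp add: t_def)
  have contr: "norm (x - t *\<^sub>R A x) \<le> q * norm x" for x
  proof (rule power2_le_imp_le)
    have "(norm (x - t *\<^sub>R A x))\<^sup>2 = (norm x)\<^sup>2 - 2 * t * inner (A x) x + t\<^sup>2 * (norm (A x))\<^sup>2"
      unfolding power2_norm_eq_inner by (simp add: inner_diff inner_commute power2_eq_square algebra_simps)
    also have "\<dots> \<le> (norm x)\<^sup>2 - 2 * t * (c * (norm x)\<^sup>2) + t\<^sup>2 * (C * norm x)\<^sup>2"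
      using t by (intro add_mono diff_mono order_refl mult_left_mono co power_mono C) auto
    also have "\<dots> = (1 - c\<^sup>2 / C\<^sup>2) * (norm x)\<^sup>2"
      using C(1) by (simp add: t_def power2_eq_square field_simps)
    finally show "(norm (x - t *\<^sub>R A x))\<^sup>2 \<le> (q * norm x)\<^sup>2" by (simp add: power_mult_distrib q(3))
  qed (use q in simp)
  define f where "f x = x - t *\<^sub>R (A x - y)" for x
  have "f x - f z = (x - z) - t *\<^sub>R A (x - z)" for x z
    by (simp add: f_def bounded_clinearD[OF A] algebra_simps)
  then have "dist (f x) (f z) \<le> q * dist x z" for x z
    using contr[of "x - z"] by (simp add: dist_norm)
  then have "\<exists>!x. f x = x" by (intro banach_fix_type[OF q(1,2)]) blast
  then obtain x where "f x = x" by blast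
  then show ?thesis using c C by (intro exI[of _ x]) (simp add: f_def t_def)
qed

text \<open>For a normal operator A with adjoint B, the operator BA is coercive as soon as A is bounded below.\<close>
lemma bounded_below_invertible:
  fixes A :: "'a::complex_hilbert_space \<Rightarrow> 'a"
  assumes A: "bounded_clinear A" and B: "bounded_clinear B"
    and adj: "\<And>x y. inner (A x) y = inner x (B y)" and comm: "\<And>x. A (B x) = B (A x)"
    and d: "d > 0" and below: "\<And>x. d * norm x \<le> norm (A x)"
  obtains R where "bounded_clinear R" "\<And>x. R (A x) = x" "\<And>x. A (R x) = x"
proof -
  have "\<exists>x. A x = y" for y
  proof -
    have "d\<^sup>2 * (norm x)\<^sup>2 \<le> inner (B (A x)) x" for x
      using power_mono[OF below[of x], of 2] d adj[of x "A x"]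
      by (simp add: power_mult_distrib power2_norm_eq_inner inner_commute)
    then obtain z where "B (A z) = y"
      using coercive_surj[OF bounded_clinear_compose[OF B A], of "d\<^sup>2" y] d by auto
    then show ?thesis using comm[of z] by metis
  qed
  then obtain R where AR: "\<And>y. A (R y) = y" by metis
  have inj: "x = y" if "A x = A y" for x y
    using below[of "x - y"] d that by (simp add: bounded_clinearD[OF A] mult_le_0_iff)
  have "norm (R x) \<le> norm x * (1 / d)" for x
    using below[of "R x"] d by (simp add: AR field_simps)
  moreover have "R (x + y) = R x + R y" "R (r *\<^sub>R x) = r *\<^sub>R R x" "R (c *\<^sub>C x) = c *\<^sub>C R x" for x y r c
    by (rule inj, simp add: AR bounded_clinearD[OF A])+
  ultimately have "bounded_clinear R"
    unfolding bounded_clinear_def by (blast intro: bounded_linear_intro)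
  moreover have "R (A x) = x" for x by (rule inj) (simp add: AR)
  ultimately show thesis using that AR by blast
qed

lemma norm_complex_shift:
  assumes T: "selfadjoint T"
  shows "(norm (T x - z *\<^sub>C x))\<^sup>2 = (norm (T x - Re z *\<^sub>R x))\<^sup>2 + (Im z)\<^sup>2 * (norm x)\<^sup>2"
proof -
  let ?N = "T x - Re z *\<^sub>R x"
  have "Im (cinner ?N x) = 0"
    using selfadjoint_cinner_self[OF selfadjoint_shift[OF T, of "Re z"], of x] by simp
  then have orth: "inner ?N (\<i> *\<^sub>C x) = 0" by (simp add: Im_cinner)
  have "z *\<^sub>C x = Re z *\<^sub>R x + Im z *\<^sub>R (\<i> *\<^sub>C x)"
  proof -
    have "z *\<^sub>C x = (complex_of_real (Re z) + complex_of_real (Im z) * \<i>) *\<^sub>C x"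
      by (metis complex_eq mult.commute)
    also have "\<dots> = complex_of_real (Re z) *\<^sub>C x + complex_of_real (Im z) *\<^sub>C \<i> *\<^sub>C x"
      by (simp only: scaleC_add_left flip: scaleC_scaleC)
    finally show ?thesis by (simp only: scaleC_of_real)
  qed
  then have eq: "T x - z *\<^sub>C x = ?N - Im z *\<^sub>R (\<i> *\<^sub>C x)" by simp
  show ?thesis unfolding eq power2_norm_eq_inner
    using orth inner_scaleC_ii[of x x]
    by (simp add: inner_diff_left[of ?N] inner_diff_right[of _ ?N] inner_commute[of "\<i> *\<^sub>C x" ?N] power2_eq_square)
qed

lemma not_in_spectrum_iff:
  fixes T :: "'a::complex_hilbert_space \<Rightarrow> 'a"
  assumes T: "selfadjoint T"
  shows "z \<notin> spectrum T \<longleftrightarrow> (\<exists>d>0. \<forall>x. d * norm x \<le> norm (T x - z *\<^sub>C x))"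
proof
  assume "z \<notin> spectrum T"
  then obtain R where R: "bounded_clinear R" "\<And>x. R (T x - z *\<^sub>C x) = x"
    unfolding spectrum_def by blast
  obtain K where K: "K > 0" "\<And>x. norm (R x) \<le> K * norm x" using bounded_clinear_bound[OF R(1)] by blast
  have "1 / K * norm x \<le> norm (T x - z *\<^sub>C x)" for x
    using K(2)[of "T x - z *\<^sub>C x"] K(1) by (simp add: R(2) field_simps)
  then show "\<exists>d>0. \<forall>x. d * norm x \<le> norm (T x - z *\<^sub>C x)" using K(1) by (intro exI[of _ "1 / K"]) auto
next
  assume "\<exists>d>0. \<forall>x. d * norm x \<le> norm (T x - z *\<^sub>C x)"
  then obtain d where d: "d > 0" "\<And>x. d * norm x \<le> norm (T x - z *\<^sub>C x)" by blast
  note lT = selfadjoint_simps[OF T]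
  have b: "bounded_clinear (\<lambda>x. T x - w *\<^sub>C x)" for w
    by (intro bounded_clinear_diff selfadjointD(1)[OF T] bounded_clinear_scaleC)
  have adj: "inner (T x - z *\<^sub>C x) y = inner x (T y - cnj z *\<^sub>C y)" for x y
    by (simp add: Re_cinner[symmetric] cinner_diff_left cinner_diff_right cinner_scaleC_left cinner_scaleC_right
        selfadjointD(2)[OF T, of x y])
  have comm: "T (T x - cnj z *\<^sub>C x) - z *\<^sub>C (T x - cnj z *\<^sub>C x) = T (T x - z *\<^sub>C x) - cnj z *\<^sub>C (T x - z *\<^sub>C x)" for x
    by (simp add: lT scaleC_diff_right scaleC_scaleC mult.commute)
  have "\<exists>R. bounded_clinear R \<and> (\<forall>x. R (T x - z *\<^sub>C x) = x) \<and> (\<forall>x. T (R x) - z *\<^sub>C R x = x)"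
  proof (rule bounded_below_invertible[where A = "\<lambda>x. T x - z *\<^sub>C x" and B = "\<lambda>x. T x - cnj z *\<^sub>C x" and d = d])
    show "d * norm x \<le> norm (T x - z *\<^sub>C x)" for x by (rule d(2))
  qed (use b adj comm d(1) in blast)+
  then show "z \<notin> spectrum T" unfolding spectrum_def by blast
qed

lemma reduced_inverse:
  fixes A P :: "'a::complex_hilbert_space \<Rightarrow> 'a"
  assumes A: "selfadjoint A" and P: "orth_projection P" and comm: "\<And>x. P (A x) = A (P x)"
    and d: "d > 0" and below: "\<And>x. P x = x \<Longrightarrow> d * norm x \<le> norm (A x)"
  obtains B where "selfadjoint B" "\<And>x. P (B x) = B x" "\<And>x. B (P x) = B x" "\<And>x. A (B x) = P x" "\<And>x. B (A x) = P x"
    "\<And>x. norm (B x) \<le> norm x / d"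
proof -
  note lA = selfadjoint_simps[OF A] and lP = selfadjoint_simps[OF orth_projectionD(1)[OF P]]
    and PP = orth_projectionD(2)[OF P]
  define A0 where "A0 x = A (P x) + d *\<^sub>R (x - P x)" for x
  have A0: "selfadjoint A0" unfolding A0_def
    by (intro selfadjoint_add selfadjoint_scaleR selfadjoint_diff selfadjoint_id orth_projectionD(1)[OF P])
      (rule selfadjoint_compose[OF A orth_projectionD(1)[OF P] comm[symmetric]])
  have PA0: "P (A0 x) = A (P x)" and A0P: "A0 (P x) = A (P x)" for x
    by (simp_all add: A0_def lP comm PP)
  have below0: "d * norm x \<le> norm (A0 x)" for x
  proof (rule power2_le_imp_le)
    have "(d * norm x)\<^sup>2 = (d * norm (P x))\<^sup>2 + (d * norm (x - P x))\<^sup>2"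
      using orth_projection_norm[OF P, of x] by (simp add: power_mult_distrib distrib_left)
    also have "\<dots> \<le> (norm (A (P x)))\<^sup>2 + (norm (d *\<^sub>R (x - P x)))\<^sup>2"
      using d PP by (intro add_mono power_mono below) auto
    also have "\<dots> = (norm (A0 x))\<^sup>2"
      using orth_projection_norm[OF P, of "A0 x"] by (simp add: PA0) (simp add: A0_def)
    finally show "(d * norm x)\<^sup>2 \<le> (norm (A0 x))\<^sup>2" .
  qed simp
  obtain R where R: "bounded_clinear R" "\<And>x. R (A0 x) = x" "\<And>x. A0 (R x) = x"
    by (rule bounded_below_invertible[OF selfadjointD(1)[OF A0] selfadjointD(1)[OF A0] selfadjointD(3)[OF A0] refl d below0], rule that)
  have PR: "P (R x) = R (P x)" for x
    by (metis R(2,3) PA0 A0P)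
  have symR: "inner (R x) y = inner x (R y)" for x y
    by (metis R(3) selfadjointD(3)[OF A0])
  have sR: "selfadjoint R" by (rule selfadjointI[OF R(1) symR])
  show thesis
  proof (rule that[of "\<lambda>x. R (P x)"])
    show "selfadjoint (\<lambda>x. R (P x))" by (rule selfadjoint_compose[OF sR orth_projectionD(1)[OF P] PR[symmetric]])
    show 1: "P (R (P x)) = R (P x)" for x by (simp add: PR PP)
    show "R (P (P x)) = R (P x)" for x by (simp add: PP)
    show 2: "A (R (P x)) = P x" for x by (metis 1 A0P R(3))
    show "R (P (A x)) = P x" for x by (metis R(2) A0P comm)
    show "norm (R (P x)) \<le> norm x / d" for x
      using below[OF 1, of x] orth_projection_norm_le[OF P, of x] d by (simp add: 2 field_simps)
  qed
qed

lemma infinite_cdim_mono: "infinite_cdim V \<Longrightarrow> V \<subseteq> W \<Longrightarrow> infinite_cdim W"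
  unfolding infinite_cdim_def by blast

lemma not_infinite_cdim_zero: "\<not> infinite_cdim {0}"
  unfolding infinite_cdim_def by (auto intro!: exI[of _ "{}"])

lemma infinite_cdim_sums:
  assumes "\<not> infinite_cdim V" "\<not> infinite_cdim W" "\<And>x. x \<in> U \<Longrightarrow> \<exists>v\<in>V. \<exists>w\<in>W. x = v + w"
  shows "\<not> infinite_cdim U"
proof -
  obtain B C where "finite B" "V \<subseteq> cspan B" "finite C" "W \<subseteq> cspan C"
    using assms(1,2) unfolding infinite_cdim_def by blast
  moreover have "cspan B \<subseteq> cspan (B \<union> C)" "cspan C \<subseteq> cspan (B \<union> C)"
    by (auto intro!: complex_vector.span_mono)
  ultimately have "U \<subseteq> cspan (B \<union> C)"
    using assms(3) by (blast intro: complex_vector.span_add)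
  then show ?thesis using \<open>finite B\<close> \<open>finite C\<close> unfolding infinite_cdim_def by blast
qed

lemma finite_cdim_extension:
  fixes G :: "'a::complex_inner \<Rightarrow> 'a"
  assumes V: "complex_vector.subspace V" and G: "bounded_clinear G" and fG: "\<not> infinite_cdim (range G)"
    and ker: "\<not> infinite_cdim {x \<in> V. G x = 0}"
  shows "\<not> infinite_cdim V"
proof -
  note lG = bounded_clinearD[OF G]
  obtain B C where B: "finite B" "{x \<in> V. G x = 0} \<subseteq> cspan B" and C: "finite C" "range G \<subseteq> cspan C"
    using fG ker unfolding infinite_cdim_def by blast
  obtain C' where C': "C' \<subseteq> G ` V" "complex_vector.independent C'" "G ` V \<subseteq> cspan C'"
    using complex_vector.maximal_independent_subset[of "G ` V"] by blast
  have "C' \<subseteq> cspan C" using C'(1) C(2) by blast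
  then have "finite C'" using complex_vector.independent_span_bound[OF C(1) C'(2)] by blast
  then obtain D where D: "D \<subseteq> V" "finite D" "C' = G ` D"
    using C'(1) finite_subset_image[of C' G V] by blast
  have DV: "cspan D \<subseteq> V" using D(1) V by (rule complex_vector.span_minimal)
  have lift: "\<exists>d\<in>cspan D. G d = y" if "y \<in> cspan C'" for y
    using that
  proof (induction rule: complex_vector.span_induct_alt)
    case base
    then show ?case using complex_vector.span_zero lG(4) by blast
  next
    case (step c x y)
    then obtain e d where "e \<in> D" "G e = x" "d \<in> cspan D" "G d = y" using D(3) by blast
    then show ?case
      by (intro bexI[of _ "c *\<^sub>C e + d"])
        (auto simp: lG intro: complex_vector.span_add complex_vector.span_scale complex_vector.span_base)
  qed
  have sub: "cspan B \<subseteq> cspan (B \<union> D)" "cspan D \<subseteq> cspan (B \<union> D)"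
    by (auto intro!: complex_vector.span_mono)
  have "V \<subseteq> cspan (B \<union> D)"
  proof
    fix v assume v: "v \<in> V"
    then obtain d where d: "d \<in> cspan D" "G d = G v" using lift[of "G v"] C'(3) by blast
    have "v - d \<in> V" using v d(1) DV V by (blast intro: complex_vector.subspace_diff)
    then have "v - d \<in> cspan B" using B(2) d(2) lG(3)[of v d] by auto
    then have "(v - d) + d \<in> cspan (B \<union> D)" using d(1) sub by (blast intro: complex_vector.span_add)
    then show "v \<in> cspan (B \<union> D)" by simp
  qed
  then show ?thesis using B(1) D(2) unfolding infinite_cdim_def by blast
qed

lemma real_not_in_spectrum_iff:
  fixes T :: "'a::complex_hilbert_space \<Rightarrow> 'a"
  assumes "selfadjoint T"
  shows "complex_of_real s \<notin> spectrum T \<longleftrightarrow> (\<exists>d>0. \<forall>x. d * norm x \<le> norm (T x - s *\<^sub>R x))"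
  using not_in_spectrum_iff[OF assms, of "complex_of_real s"] by simp

lemma ess_spectrum_locally_isolated:
  fixes T :: "'a::complex_hilbert_space \<Rightarrow> 'a"
  assumes T: "selfadjoint T" and s: "s \<notin> ess_spectrum T"
  shows "\<exists>e>0. \<forall>t. \<bar>t - s\<bar> < e \<longrightarrow> t \<noteq> s \<longrightarrow> complex_of_real t \<notin> spectrum T"
proof (cases "complex_of_real s \<in> spectrum T")
  case True
  then have "complex_of_real s isolated_in spectrum T"
    using s by (auto simp: ess_spectrum_def discrete_spectrum_def)
  then obtain e where "e > 0" "\<And>z. z \<in> spectrum T \<Longrightarrow> dist (complex_of_real s) z < e \<Longrightarrow> z = complex_of_real s"
    unfolding isolated_in_dist_Ex_iff by (metis dist_commute)
  then have "complex_of_real t \<notin> spectrum T" if "\<bar>t - s\<bar> < e" "t \<noteq> s" for t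
    using that \<open>\<And>z. z \<in> spectrum T \<Longrightarrow> dist (complex_of_real s) z < e \<Longrightarrow> z = complex_of_real s\<close>
    by (metis dist_of_real dist_real_def abs_minus_commute of_real_eq_iff)
  then show ?thesis using \<open>e > 0\<close> by blast
next
  case False
  then obtain d where d: "d > 0" "\<And>x. d * norm x \<le> norm (T x - s *\<^sub>R x)"
    using real_not_in_spectrum_iff[OF T] by blast
  have "complex_of_real t \<notin> spectrum T" if t: "\<bar>t - s\<bar> < d" for t
    unfolding real_not_in_spectrum_iff[OF T]
  proof (intro exI conjI allI)
    show "d - \<bar>t - s\<bar> > 0" using t by simp
    fix x
    have "T x - s *\<^sub>R x = (T x - t *\<^sub>R x) + (t - s) *\<^sub>R x" by (simp add: algebra_simps)
    then have "norm (T x - s *\<^sub>R x) \<le> norm (T x - t *\<^sub>R x) + \<bar>t - s\<bar> * norm x"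
      by (metis norm_triangle_ineq norm_scaleR)
    then show "(d - \<bar>t - s\<bar>) * norm x \<le> norm (T x - t *\<^sub>R x)"
      using d(2)[of x] by (simp add: left_diff_distrib)
  qed
  then show ?thesis using d(1) by blast
qed

lemma closed_ess_spectrum:
  fixes T :: "'a::complex_hilbert_space \<Rightarrow> 'a"
  assumes T: "selfadjoint T" shows "closed (ess_spectrum T)"
  unfolding closed_def open_dist
proof
  fix s assume s: "s \<in> - ess_spectrum T"
  then obtain e where e: "e > 0" "\<And>t. \<bar>t - s\<bar> < e \<Longrightarrow> t \<noteq> s \<Longrightarrow> complex_of_real t \<notin> spectrum T"
    using ess_spectrum_locally_isolated[OF T, of s] by auto
  then show "\<exists>e>0. \<forall>y. dist y s < e \<longrightarrow> y \<in> - ess_spectrum T"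
    using s by (intro exI[of _ e]) (auto simp: dist_real_def ess_spectrum_def)
qed

lemma ess_spectrum_bounded:
  fixes T :: "'a::complex_hilbert_space \<Rightarrow> 'a"
  assumes T: "selfadjoint T" and K: "\<And>x. norm (T x) \<le> K * norm x" and s: "s \<in> ess_spectrum T"
  shows "\<bar>s\<bar> \<le> K"
proof (rule ccontr)
  assume less: "\<not> \<bar>s\<bar> \<le> K"
  have "(\<bar>s\<bar> - K) * norm x \<le> norm (T x - s *\<^sub>R x)" for x
    using norm_triangle_ineq2[of "s *\<^sub>R x" "T x"] K[of x] by (simp add: left_diff_distrib norm_minus_commute)
  then have "complex_of_real s \<notin> spectrum T"
    unfolding real_not_in_spectrum_iff[OF T] using less by (intro exI[of _ "\<bar>s\<bar> - K"]) auto
  then show False using s by (simp add: ess_spectrum_def)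
qed

context spectral_measure
begin

lemma range_E_mono:
  assumes "A \<in> sets borel" "B \<in> sets borel" "A \<subseteq> B" shows "range (E A) \<subseteq> range (E B)"
proof
  fix y assume "y \<in> range (E A)"
  then have "E B y = y" using E_mono[OF assms] orth_projectionD(2)[OF proj[OF assms(1)]] by auto
  then show "y \<in> range (E B)" by (metis rangeI)
qed

lemma E_zero_near_resolvent:
  assumes "complex_of_real s \<notin> spectrum T"
  shows "\<exists>e>0. \<forall>x. E {s - e<..<s + e} x = 0"
proof -
  obtain d where d: "d > 0" "\<And>x. d * norm x \<le> norm (T x - s *\<^sub>R x)"
    using assms real_not_in_spectrum_iff[OF selfadjoint] by blast
  have "E {s - d/2<..<s + d/2} x = 0" for x
  proof -
    let ?y = "E {s - d/2<..<s + d/2} x"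
    have "norm (T ?y - s *\<^sub>R ?y) \<le> d/2 * norm ?y"
      using d(1) by (intro norm_shift_le[of "{s - d/2<..<s + d/2}"]) (auto simp: orth_projectionD(2)[OF proj])
    then have "d * norm ?y \<le> d/2 * norm ?y" using d(2)[of ?y] by linarith
    then show ?thesis using d(1) by (simp add: field_simps mult_le_0_iff)
  qed
  then show ?thesis using d(1) by (intro exI[of _ "d/2"]) auto
qed

lemma E_singleton_eigen: "T (E {s} x) = s *\<^sub>R E {s} x"
  using norm_shift_le[of "{s}" s 0 "E {s} x"] by (simp add: orth_projectionD(2)[OF proj])

lemma finite_range_near:
  assumes s: "s \<notin> ess_spectrum T"
  shows "\<exists>e>0. \<not> infinite_cdim (range (E {s - e<..<s + e}))"
proof (cases "complex_of_real s \<in> spectrum T")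
  case False
  then obtain e where "e > 0" "\<And>x. E {s - e<..<s + e} x = 0" using E_zero_near_resolvent by blast
  moreover from this have "range (E {s - e<..<s + e}) = {0}" by auto
  ultimately show ?thesis using not_infinite_cdim_zero by metis
next
  case True
  then have fin: "\<not> infinite_cdim (op_kernel (\<lambda>x. T x - complex_of_real s *\<^sub>C x))"
    using s by (auto simp: ess_spectrum_def discrete_spectrum_def)
  obtain e where e: "e > 0" "\<And>t. \<bar>t - s\<bar> < e \<Longrightarrow> t \<noteq> s \<Longrightarrow> complex_of_real t \<notin> spectrum T"
    using ess_spectrum_locally_isolated[OF selfadjoint s] by blast
  have "E ({s - e<..<s + e} - {s}) x = 0" for x
  proof (rule E_null_local)
    fix t assume "t \<in> {s - e<..<s + e} - {s}"
    then have "complex_of_real t \<notin> spectrum T" by (intro e(2)) auto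
    then show "\<exists>e>0. E {t - e<..<t + e} x = 0" using E_zero_near_resolvent by blast
  qed auto
  moreover have "E {s - e<..<s + e} x = E {s} x + E ({s - e<..<s + e} - {s}) x" for x
  proof -
    have "{s - e<..<s + e} = {s} \<union> ({s - e<..<s + e} - {s})" using e(1) by auto
    then show ?thesis using E_Un[of "{s}" "{s - e<..<s + e} - {s}" x] by simp
  qed
  ultimately have "range (E {s - e<..<s + e}) \<subseteq> op_kernel (\<lambda>x. T x - complex_of_real s *\<^sub>C x)"
    by (auto simp: op_kernel_def E_singleton_eigen)
  then show ?thesis using fin e(1) infinite_cdim_mono by blast
qed

lemma finite_range_Icc:
  assumes ab: "a \<le> b" and free: "\<And>s. s \<in> {a..b} \<Longrightarrow> s \<notin> ess_spectrum T"
  shows "\<not> infinite_cdim (range (E {a..b}))"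
  using ab
proof (induction rule: Bolzano)
  case (trans u v w)
  show ?case
  proof (rule infinite_cdim_sums[OF trans(1,2)])
    fix x assume "x \<in> range (E {u..w})"
    then obtain z where z: "x = E {u..w} z" by blast
    have "{u..w} = {u..v} \<union> {v<..w}" "{u..v} \<inter> {v<..w} = {}" using trans by auto
    then have "x = E {u..v} z + E {v<..w} z" unfolding z using E_Un[of "{u..v}" "{v<..w}" z] by simp
    moreover have "range (E {v<..w}) \<subseteq> range (E {v..w})" by (rule range_E_mono) auto
    ultimately show "\<exists>p\<in>range (E {u..v}). \<exists>q\<in>range (E {v..w}). x = p + q" by blast
  qed
next
  case (local s)
  then obtain e where e: "e > 0" "\<not> infinite_cdim (range (E {s - e<..<s + e}))"
    using finite_range_near free by auto
  have "\<not> infinite_cdim (range (E {u..v}))" if "u \<le> s \<and> s \<le> v \<and> v - u < e" for u v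
  proof -
    have "{u..v} \<subseteq> {s - e<..<s + e}" using that by (intro subsetI) auto
    then show ?thesis using e(2) infinite_cdim_mono[OF _ range_E_mono[of "{u..v}" "{s - e<..<s + e}"]] by auto
  qed
  then show ?case using e(1) by blast
qed

lemma E_atMost_zero:
  assumes K: "\<And>x. norm (T x) \<le> K * norm x" and b: "b < - K" shows "E {..b} x = 0"
proof -
  let ?y = "E {..b} x"
  have "inner (T ?y) ?y \<le> b * (norm ?y)\<^sup>2"
    by (rule form_le[of "{..b}"]) (auto simp: orth_projectionD(2)[OF proj])
  moreover have "- (K * (norm ?y)\<^sup>2) \<le> inner (T ?y) ?y"
    using Cauchy_Schwarz_ineq2[of "T ?y" ?y] mult_right_mono[OF K[of ?y], of "norm ?y"] by (simp add: power2_eq_square)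
  ultimately have "0 \<le> (K + b) * (norm ?y)\<^sup>2" by (simp add: distrib_right)
  then show ?thesis using b by (auto simp: zero_le_mult_iff)
qed

lemma E_atLeast_zero:
  assumes K: "\<And>x. norm (T x) \<le> K * norm x" and b: "b > K" shows "E {b..} x = 0"
proof -
  let ?y = "E {b..} x"
  have "b * (norm ?y)\<^sup>2 \<le> inner (T ?y) ?y"
    by (rule form_ge[of "{b..}"]) (auto simp: orth_projectionD(2)[OF proj])
  moreover have "inner (T ?y) ?y \<le> K * (norm ?y)\<^sup>2"
    using Cauchy_Schwarz_ineq2[of "T ?y" ?y] mult_right_mono[OF K[of ?y], of "norm ?y"] by (simp add: power2_eq_square)
  ultimately have "0 \<le> (K - b) * (norm ?y)\<^sup>2" by (simp add: left_diff_distrib)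
  then show ?thesis using b by (auto simp: zero_le_mult_iff)
qed

lemma finite_range_atLeast:
  assumes free: "\<And>s. s \<ge> a \<Longrightarrow> s \<notin> ess_spectrum T"
  shows "\<not> infinite_cdim (range (E {a..}))"
proof -
  obtain K where K: "\<And>x. norm (T x) \<le> K * norm x"
    using bounded_clinear_bound[OF selfadjointD(1)[OF selfadjoint]] by metis
  define b where "b = max a (K + 1)"
  have b: "a \<le> b" "b > K" unfolding b_def by auto
  have "E {a..} x = E {a..b} x" for x
  proof -
    have "{a..} = {a..b} \<union> {b<..}" "{a..b} \<inter> {b<..} = {}" using b by auto
    moreover have "E {b<..} x = 0" by (rule E_null_mono[of _ "{b..}"]) (auto intro!: E_atLeast_zero[OF K b(2)])
    ultimately show ?thesis using E_Un[of "{a..b}" "{b<..}" x] by auto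
  qed
  then have "range (E {a..}) = range (E {a..b})" by auto
  then show ?thesis using finite_range_Icc[OF b(1)] free by auto
qed

lemma finite_range_atMost:
  assumes free: "\<And>s. s \<le> a \<Longrightarrow> s \<notin> ess_spectrum T"
  shows "\<not> infinite_cdim (range (E {..a}))"
proof -
  obtain K where K: "\<And>x. norm (T x) \<le> K * norm x"
    using bounded_clinear_bound[OF selfadjointD(1)[OF selfadjoint]] by metis
  define b where "b = min a (- K - 1)"
  have b: "b \<le> a" "b < - K" unfolding b_def by auto
  have "E {..a} x = E {b..a} x" for x
  proof -
    have "{..a} = {b..a} \<union> {..<b}" "{b..a} \<inter> {..<b} = {}" using b by auto
    moreover have "E {..<b} x = 0" by (rule E_null_mono[of _ "{..b}"]) (auto intro!: E_atMost_zero[OF K b(2)])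
    ultimately show ?thesis using E_Un[of "{b..a}" "{..<b}" x] by auto
  qed
  then have "range (E {..a}) = range (E {b..a})" by auto
  then show ?thesis using finite_range_Icc[OF b(1)] free by auto
qed

lemma ess_spectrum_nonempty:
  assumes inf: "infinite_cdim (UNIV :: 'a set)" shows "ess_spectrum T \<noteq> {}"
proof
  assume "ess_spectrum T = {}"
  then have "\<not> infinite_cdim (range (E {0..}))" "\<not> infinite_cdim (range (E {..0}))"
    by (auto intro!: finite_range_atLeast finite_range_atMost)
  then have "\<not> infinite_cdim (UNIV :: 'a set)"
  proof (rule infinite_cdim_sums)
    fix x
    have "x = E {0..} x + E {..<0} x" using E_compl[of "{0..}" x] by (simp add: Compl_atLeast)
    moreover have "range (E {..<0}) \<subseteq> range (E {..0})" by (rule range_E_mono) auto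
    ultimately show "\<exists>v\<in>range (E {0..}). \<exists>w\<in>range (E {..0}). x = v + w" by blast
  qed
  then show False using inf by contradiction
qed

lemma min_ess:
  assumes inf: "infinite_cdim (UNIV :: 'a set)"
  shows "min_ess T \<in> ess_spectrum T" "s \<in> ess_spectrum T \<Longrightarrow> min_ess T \<le> s"
proof -
  obtain K where K: "\<And>x. norm (T x) \<le> K * norm x"
    using bounded_clinear_bound[OF selfadjointD(1)[OF selfadjoint]] by metis
  have bb: "bdd_below (ess_spectrum T)"
    using ess_spectrum_bounded[OF selfadjoint K] by (intro bdd_belowI[of _ "- K"]) (simp add: abs_le_iff minus_le_iff)
  have I: "Inf (ess_spectrum T) \<in> ess_spectrum T"
    using closed_contains_Inf[OF ess_spectrum_nonempty[OF inf] bb closed_ess_spectrum[OF selfadjoint]] .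
  have "min_ess T = Inf (ess_spectrum T)"
    unfolding min_ess_def using I by (rule Least_equality) (rule cInf_lower[OF _ bb])
  then show "min_ess T \<in> ess_spectrum T" "s \<in> ess_spectrum T \<Longrightarrow> min_ess T \<le> s"
    using I cInf_lower[OF _ bb] by auto
qed

lemma max_ess:
  assumes inf: "infinite_cdim (UNIV :: 'a set)"
  shows "max_ess T \<in> ess_spectrum T" "s \<in> ess_spectrum T \<Longrightarrow> s \<le> max_ess T"
proof -
  obtain K where K: "\<And>x. norm (T x) \<le> K * norm x"
    using bounded_clinear_bound[OF selfadjointD(1)[OF selfadjoint]] by metis
  have bb: "bdd_above (ess_spectrum T)"
    using ess_spectrum_bounded[OF selfadjoint K] by (intro bdd_aboveI[of _ K]) (simp add: abs_le_iff)
  have I: "Sup (ess_spectrum T) \<in> ess_spectrum T"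
    using closed_contains_Sup[OF ess_spectrum_nonempty[OF inf] bb closed_ess_spectrum[OF selfadjoint]] .
  have "max_ess T = Sup (ess_spectrum T)"
    unfolding max_ess_def using I by (rule Greatest_equality) (rule cSup_upper[OF _ bb])
  then show "max_ess T \<in> ess_spectrum T" "s \<in> ess_spectrum T \<Longrightarrow> s \<le> max_ess T"
    using I cSup_upper[OF _ bb] by auto
qed

lemma not_in_ess_spectrum_isolated:
  assumes e: "e > 0" and null: "\<And>x. E ({l - e<..<l + e} - {l}) x = 0"
    and fin: "\<not> infinite_cdim (range (E {l}))"
  shows "l \<notin> ess_spectrum T"
proof -
  let ?U = "{l - e<..<l + e}"
  have compl: "E (- {l}) x = E (- ?U) x" for x
  proof -
    have "- {l} = - ?U \<union> (?U - {l})" using e by auto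
    then have "E (- {l}) x = E (- ?U) x + E (?U - {l}) x"
      using E_Un[of "- ?U" "?U - {l}" x] by auto
    then show ?thesis using null by simp
  qed
  have split: "x = E {l} x + E (- ?U) x" for x
    using E_compl[of "{l}" x] compl[of x] by simp
  have outside: "(e - \<bar>t - l\<bar>) * norm (E (- ?U) x) \<le> norm (T (E (- ?U) x) - t *\<^sub>R E (- ?U) x)"
    if "\<bar>t - l\<bar> \<le> e" for t x
    using that by (intro norm_shift_ge[of "- ?U"]) (auto simp: orth_projectionD(2)[OF proj])
  have resolvent: "z \<notin> spectrum T" if z: "dist z (complex_of_real l) < e" "z \<noteq> complex_of_real l" for z
  proof -
    let ?l = "complex_of_real l"
    have zl: "(dist z ?l)\<^sup>2 = (Re z - l)\<^sup>2 + (Im z)\<^sup>2" by (simp add: dist_norm cmod_power2)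
    have Re: "\<bar>Re z - l\<bar> < e" using z(1) abs_Re_le_cmod[of "z - ?l"] by (simp add: dist_norm)
    define d where "d = min (dist z ?l) (e - \<bar>Re z - l\<bar>)"
    have d: "d > 0" using z(2) Re by (simp add: d_def)
    have "d * norm x \<le> norm (T x - z *\<^sub>C x)" for x
    proof (rule power2_le_imp_le)
      let ?y = "E {l} x" and ?w = "E (- ?U) x"
      have nx: "(norm x)\<^sup>2 = (norm ?y)\<^sup>2 + (norm ?w)\<^sup>2"
        using orth_projection_norm[OF proj, of "{l}" x] E_compl[of "{l}" x] compl[of x] by simp
      have "(d * norm x)\<^sup>2 = d\<^sup>2 * (norm ?y)\<^sup>2 + (d * norm ?w)\<^sup>2"
        by (simp add: power_mult_distrib nx distrib_left)
      also have "\<dots> \<le> (dist z ?l)\<^sup>2 * (norm ?y)\<^sup>2 + ((e - \<bar>Re z - l\<bar>) * norm ?w)\<^sup>2"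
        using d Re by (intro add_mono mult_right_mono power_mono) (auto simp: d_def)
      also have "\<dots> \<le> (dist z ?l)\<^sup>2 * (norm ?y)\<^sup>2 + (norm (T ?w - Re z *\<^sub>R ?w))\<^sup>2"
        using Re outside[of "Re z" x] by (intro add_left_mono power_mono) auto
      also have "\<dots> = (Im z)\<^sup>2 * (norm ?y)\<^sup>2 + ((norm (T ?y - Re z *\<^sub>R ?y))\<^sup>2 + (norm (T ?w - Re z *\<^sub>R ?w))\<^sup>2)"
      proof -
        have "T ?y - Re z *\<^sub>R ?y = (l - Re z) *\<^sub>R ?y" by (simp add: E_singleton_eigen scaleR_diff_left)
        then have "(norm (T ?y - Re z *\<^sub>R ?y))\<^sup>2 = (Re z - l)\<^sup>2 * (norm ?y)\<^sup>2"
          by (simp add: power_mult_distrib power2_commute)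
        then show ?thesis by (simp add: zl distrib_right)
      qed
      also have "\<dots> = (Im z)\<^sup>2 * (norm ?y)\<^sup>2 + (norm (T x - Re z *\<^sub>R x))\<^sup>2"
        using norm_shift_split[of "{l}" x "Re z"] by (simp add: compl)
      also have "\<dots> \<le> (Im z)\<^sup>2 * (norm x)\<^sup>2 + (norm (T x - Re z *\<^sub>R x))\<^sup>2"
        by (intro add_right_mono mult_left_mono) (auto simp: nx)
      also have "\<dots> = (norm (T x - z *\<^sub>C x))\<^sup>2" using norm_complex_shift[OF selfadjoint, of x z] by simp
      finally show "(d * norm x)\<^sup>2 \<le> (norm (T x - z *\<^sub>C x))\<^sup>2" .
    qed simp
    then show ?thesis using not_in_spectrum_iff[OF selfadjoint] d by blast
  qed
  show ?thesis
  proof (cases "\<forall>x. E {l} x = 0")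
    case True
    then have "e * norm x \<le> norm (T x - l *\<^sub>R x)" for x
      using outside[of l x] e split[of x] by simp
    then have "complex_of_real l \<notin> spectrum T" using real_not_in_spectrum_iff[OF selfadjoint] e by blast
    then show ?thesis by (simp add: ess_spectrum_def)
  next
    case False
    then obtain x where "E {l} x \<noteq> 0" by blast
    then have ker: "op_kernel (\<lambda>x. T x - complex_of_real l *\<^sub>C x) \<noteq> {0}"
      using E_singleton_eigen[of l x] by (auto simp: op_kernel_def)
    have "op_kernel (\<lambda>x. T x - complex_of_real l *\<^sub>C x) \<subseteq> range (E {l})"
    proof
      fix x assume "x \<in> op_kernel (\<lambda>x. T x - complex_of_real l *\<^sub>C x)"
      then have "T x - l *\<^sub>R x = 0" by (simp add: op_kernel_def)
      then have "T (E (- ?U) x) - l *\<^sub>R E (- ?U) x = 0"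
        using E_shift_commute[of "- ?U" x l] by (simp add: lin_E)
      then have "e * norm (E (- ?U) x) \<le> 0" using outside[of l x] e by simp
      then have "E (- ?U) x = 0" using e by (simp add: mult_le_0_iff)
      then show "x \<in> range (E {l})" using split[of x] by (metis add.right_neutral rangeI)
    qed
    then have "\<not> infinite_cdim (op_kernel (\<lambda>x. T x - complex_of_real l *\<^sub>C x))"
      using fin infinite_cdim_mono by blast
    moreover have "complex_of_real l isolated_in spectrum T" if "complex_of_real l \<in> spectrum T"
      unfolding isolated_in_dist_Ex_iff using that e resolvent by (metis dist_commute)
    ultimately show ?thesis using ker by (auto simp: ess_spectrum_def discrete_spectrum_def)
  qed
qed

text \<open>Each of n subintervals of length h contributes O(h^2) to the spectral measure of p, in total O(1/n).\<close>
lemma E_null_bounded_preimages: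
  assumes ab: "a < b" and w: "\<And>s. s \<in> {a..b} \<Longrightarrow> \<exists>w. T w - s *\<^sub>R w = p \<and> norm w \<le> k"
  shows "E {a<..b} p = 0"
proof -
  have step: "norm (E {s<..s + h} p) \<le> h * k" if s: "s \<in> {a..b}" and h: "h \<ge> 0" for s h
  proof -
    obtain w where w: "T w - s *\<^sub>R w = p" "norm w \<le> k" using assms(2)[OF s] by blast
    let ?y = "E {s<..s + h} w"
    have "norm (E {s<..s + h} p) = norm (T ?y - s *\<^sub>R ?y)"
      using E_shift_commute[of "{s<..s + h}" w s] w(1) by simp
    also have "\<dots> \<le> h * norm ?y"
      using h by (intro norm_shift_le[of "{s<..s + h}"]) (auto simp: orth_projectionD(2)[OF proj])
    also have "\<dots> \<le> h * k"
      using orth_projection_norm_le[OF proj, of "{s<..s + h}" w] w(2) h by (intro mult_left_mono) auto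
    finally show ?thesis .
  qed
  have "(norm (E {a<..b} p))\<^sup>2 \<le> ((b - a) * k)\<^sup>2 / real (Suc m)" for m
  proof -
    define h where "h = (b - a) / real (Suc m)"
    have h: "h > 0" using ab by (simp add: h_def)
    have hb: "h * real (Suc m) = b - a" unfolding h_def by (simp del: of_nat_Suc)
    have "(norm (E {a<..a + real i * h} p))\<^sup>2 \<le> real i * (h * k)\<^sup>2" if "i \<le> Suc m" for i
      using that
    proof (induction i)
      case (Suc i)
      let ?t = "a + real i * h"
      have t: "?t \<in> {a..b}"
      proof -
        have "real i * h \<le> real (Suc m) * h" using Suc.prems h by (intro mult_right_mono) auto
        also have "\<dots> = b - a" using hb by (simp only: mult.commute)
        finally show ?thesis using h by simp
      qed
      have "{a<..?t + h} = {a<..?t} \<union> {?t<..?t + h}"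
        using h mult_nonneg_nonneg[of "real i" h] by (auto simp: ivl_disj_un_two)
      moreover have disj: "{a<..?t} \<inter> {?t<..?t + h} = {}" by auto
      ultimately have eq: "E {a<..?t + h} p = E {a<..?t} p + E {?t<..?t + h} p"
        using E_Un[of "{a<..?t}" "{?t<..?t + h}" p] by simp
      have "inner (E {a<..?t} p) (E {?t<..?t + h} p) = 0"
        using E_disjoint[of "{a<..?t}" "{?t<..?t + h}" p] disj inner_E[of "{a<..?t}" p "E {?t<..?t + h} p"] by simp
      then have "(norm (E {a<..?t + h} p))\<^sup>2 = (norm (E {a<..?t} p))\<^sup>2 + (norm (E {?t<..?t + h} p))\<^sup>2"
        unfolding eq by (simp add: norm_add_Pythagorean orthogonal_def)
      also have "\<dots> \<le> real i * (h * k)\<^sup>2 + (h * k)\<^sup>2"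
        using Suc step[OF t, of h] h by (intro add_mono power_mono) auto
      finally show ?case by (simp add: algebra_simps)
    qed (simp add: E_empty)
    from this[of "Suc m"] have "(norm (E {a<..b} p))\<^sup>2 \<le> real (Suc m) * (h * k)\<^sup>2"
      using hb by (simp add: mult.commute[of h] del: of_nat_Suc)
    also have "\<dots> = ((b - a) * k)\<^sup>2 / real (Suc m)"
      unfolding h_def by (simp add: power2_eq_square del: of_nat_Suc)
    finally show ?thesis .
  qed
  moreover have "(\<lambda>m. ((b - a) * k)\<^sup>2 / real (Suc m)) \<longlonglongrightarrow> 0" by real_asymp
  ultimately have "(norm (E {a<..b} p))\<^sup>2 \<le> 0"
    by (intro LIMSEQ_le_const) auto
  then show ?thesis by simp
qed

end

section \<open>Rank one perturbations with a cyclic vector\<close>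

locale cyclic_spectral_measure = spectral_measure E T
  for E :: "real set \<Rightarrow> 'a::complex_hilbert_space \<Rightarrow> 'a" and T :: "'a \<Rightarrow> 'a" +
  fixes \<phi> :: 'a
  assumes cyclic: "\<And>y. (\<And>A. A \<in> sets borel \<Longrightarrow> cinner y (E A \<phi>) = 0) \<Longrightarrow> y = 0"
begin

lemma E_null_cyclic:
  assumes A: "A \<in> sets borel" and "E A \<phi> = 0" shows "E A y = 0"
proof (rule cyclic)
  fix B :: "real set" assume B: "B \<in> sets borel"
  have "E A (E B \<phi>) = 0" using E_Int[OF A B, of \<phi>] E_Int[OF B A, of \<phi>] assms(2) B by (simp add: lin_E Int_commute)
  then show "cinner (E A y) (E B \<phi>) = 0" using A by (simp add: cinner_E)
qed

lemma finite_range_singleton: "\<not> infinite_cdim (range (E {s}))"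
proof -
  let ?p = "E {s} \<phi>"
  have EE: "E {s} (E {s} x) = E {s} x" for x by (simp add: orth_projectionD(2)[OF proj])
  have "E {s} x \<in> cspan {?p}" for x
  proof -
    define c where "c = cinner (E {s} x) ?p / cinner ?p ?p"
    define w where "w = E {s} x - c *\<^sub>C ?p"
    have Ew: "E {s} w = w" by (simp add: w_def lin_E EE)
    have "w = 0"
    proof (cases "?p = 0")
      case True
      then show ?thesis using E_null_cyclic[of "{s}" x] by (simp add: w_def)
    next
      case False
      have wp: "cinner w ?p = 0"
        using False by (simp add: w_def c_def cinner_diff_left cinner_scaleC_left cinner_self)
      show ?thesis
      proof (rule cyclic)
        fix A :: "real set" assume A: "A \<in> sets borel"
        have "cinner w (E A \<phi>) = cinner w (E ({s} \<inter> A) \<phi>)"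
          using cinner_E[of "{s}" w "E A \<phi>"] E_Int[of "{s}" A \<phi>] A by (simp add: Ew)
        also have "\<dots> = 0" using wp by (cases "s \<in> A") (simp_all add: E_empty)
        finally show "cinner w (E A \<phi>) = 0" .
      qed
    qed
    then have "E {s} x = c *\<^sub>C ?p" by (simp add: w_def)
    then show ?thesis by (simp add: complex_vector.span_base complex_vector.span_scale)
  qed
  then show ?thesis unfolding infinite_cdim_def by (auto intro!: exI[of _ "{?p}"])
qed

lemma cyclic_powers:
  assumes "\<And>n. cinner ((T ^^ n) y) \<phi> = 0" shows "y = 0"
proof (rule cyclic)
  let ?L = "{y. \<forall>n. cinner ((T ^^ n) y) \<phi> = 0}"
  note lTn = selfadjoint_simps[OF selfadjoint_funpow[OF selfadjoint]]
  have sub: "subspace ?L"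
    by (auto simp: subspace_def lTn cinner_add_left cinner_scaleR_left)
  have "closed {y. cinner ((T ^^ n) y) \<phi> = 0}" for n
  proof (rule closed_Collect_eq)
    show "continuous_on UNIV (\<lambda>y. cinner ((T ^^ n) y) \<phi>)"
      using bounded_linear_compose[OF bounded_linear_cinner_left[of \<phi>]
          bounded_clinearD(1)[OF selfadjointD(1)[OF selfadjoint_funpow[OF selfadjoint, of n]]]]
      by (rule linear_continuous_on)
  qed (rule continuous_on_const)
  then have closed: "closed ?L" by (rule closed_Collect_all)
  have inv: "T ` ?L \<subseteq> ?L"
  proof (intro image_subsetI CollectI allI)
    fix y n assume "y \<in> ?L"
    then have "cinner ((T ^^ Suc n) y) \<phi> = 0" by blast
    then show "cinner ((T ^^ n) (T y)) \<phi> = 0" by (simp add: funpow_swap1)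
  qed
  fix A :: "real set" assume A: "A \<in> sets borel"
  have "E A y \<in> ?L" by (rule E_invariant_subspace[OF sub closed inv _ A]) (simp add: assms)
  then have "cinner ((T ^^ 0) (E A y)) \<phi> = 0" by blast
  then show "cinner y (E A \<phi>) = 0" using A by (simp add: cinner_E)
qed

text \<open>The vanishing of all moments of x under the inverse B of T' - s on the range of Q spreads,
  by a Neumann series for T' - s in powers of B, to a T-invariant subspace orthogonal to the
  cyclic vector.\<close>
lemma reduced_resolvent_moments_zero:
  fixes Q B :: "'a \<Rightarrow> 'a"
  assumes T': "selfadjoint (\<lambda>y. T y + cinner y \<phi> *\<^sub>C \<phi>)" and Q: "orth_projection Q"
    and B: "selfadjoint B" and QB: "\<And>x. Q (B x) = B x"
    and TB: "\<And>x. T (B x) + cinner (B x) \<phi> *\<^sub>C \<phi> - s *\<^sub>R B x = Q x"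
    and BT: "\<And>x. B (T x + cinner x \<phi> *\<^sub>C \<phi> - s *\<^sub>R x) = Q x"
    and QA: "\<And>x. Q (T x + cinner x \<phi> *\<^sub>C \<phi> - s *\<^sub>R x) = T (Q x) + cinner (Q x) \<phi> *\<^sub>C \<phi> - s *\<^sub>R Q x"
    and x: "Q x = x" and zero: "\<And>n. cinner ((B ^^ Suc n) x) \<phi> = 0"
  shows "x = 0"
proof -
  define A where "A y = T y + cinner y \<phi> *\<^sub>C \<phi> - s *\<^sub>R y" for y
  have A: "selfadjoint A" unfolding A_def by (rule selfadjoint_shift[OF T'])
  have AB: "A (B x) = Q x" and BA: "B (A x) = Q x" and QA: "Q (A x) = A (Q x)" for x
    using TB BT QA by (simp_all add: A_def)
  note lA = selfadjoint_simps[OF A] and lB = selfadjoint_simps[OF B] and lQ = selfadjoint_simps[OF orth_projectionD(1)[OF Q]]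
  note lBn = selfadjoint_simps[OF selfadjoint_funpow[OF B]]
  define K where "K = {y. Q y = y \<and> (\<forall>n. cinner ((B ^^ n) y) \<phi> = 0)}"
  have K_add: "y + z \<in> K" if "y \<in> K" "z \<in> K" for y z
    using that by (simp add: K_def lQ lBn cinner_add_left)
  have K_scale: "r *\<^sub>R y \<in> K" if "y \<in> K" for y r
    using that by (simp add: K_def lQ lBn cinner_scaleR_left)
  have K_B: "B y \<in> K" if "y \<in> K" for y
  proof -
    have "cinner ((B ^^ Suc n) y) \<phi> = 0" for n using that unfolding K_def by blast
    then show ?thesis by (simp add: K_def QB funpow_swap1)
  qed
  obtain M where M: "M > 0" "\<And>x. norm (B x) \<le> M * norm x" using bounded_clinear_bound[OF selfadjointD(1)[OF B]] by blast
  obtain C0 where C0: "C0 > 0" "\<And>x. norm (A x) \<le> C0 * norm x" using bounded_clinear_bound[OF selfadjointD(1)[OF A]] by blast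
  define C where "C = C0 + 1 / M"
  have C: "C > 0" "1 \<le> C * M" "\<And>x. norm (A x) \<le> C * norm x"
  proof -
    show "C > 0" "1 \<le> C * M" using C0(1) M(1) by (auto simp: C_def distrib_right add_pos_pos)
    show "norm (A x) \<le> C * norm x" for x
      using C0(2)[of x] M(1) divide_nonneg_pos[of "norm x" M] by (simp add: C_def distrib_right add_increasing2)
  qed
  define F where "F w = w - (1 / M\<^sup>2) *\<^sub>R B (B w)" for w
  define q where "q = sqrt (1 - 1 / (C * M)\<^sup>2)"
  have "1 / (C * M)\<^sup>2 \<le> 1" using one_le_power[OF C(2), of 2] by (simp only: divide_le_eq_1) auto
  then have q: "q \<ge> 0" "q < 1" "q\<^sup>2 = 1 - 1 / (C * M)\<^sup>2" using C(1) M(1) by (auto simp: q_def)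
  have QF: "Q (F w) = F w" if "Q w = w" for w using that by (simp add: F_def lQ QB)
  have F_norm: "norm (F w) \<le> q * norm w" if w: "Q w = w" for w
  proof (rule power2_le_imp_le)
    have "norm w \<le> C * norm (B w)" using C(3)[of "B w"] by (simp add: AB w)
    then have "(norm w)\<^sup>2 \<le> (C * norm (B w))\<^sup>2" by (intro power_mono) auto
    then have low: "(norm w)\<^sup>2 / C\<^sup>2 \<le> (norm (B w))\<^sup>2" using C(1) by (simp add: power_mult_distrib field_simps)
    have up: "(norm (B (B w)))\<^sup>2 \<le> M\<^sup>2 * (norm (B w))\<^sup>2"
      using power_mono[OF M(2)[of "B w"], of 2] by (simp add: power_mult_distrib)
    have "(norm (F w))\<^sup>2 = (norm w)\<^sup>2 - 2 * (1 / M\<^sup>2) * (norm (B w))\<^sup>2 + (1 / M\<^sup>2)\<^sup>2 * (norm (B (B w)))\<^sup>2"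
      unfolding power2_norm_eq_inner F_def
      by (simp add: inner_diff selfadjointD(3)[OF B, of "B w" w] selfadjointD(3)[OF B, of w "B w", symmetric]
          power2_eq_square algebra_simps)
    also have "\<dots> \<le> (norm w)\<^sup>2 - 2 * (1 / M\<^sup>2) * (norm (B w))\<^sup>2 + (1 / M\<^sup>2)\<^sup>2 * (M\<^sup>2 * (norm (B w))\<^sup>2)"
      by (intro add_left_mono mult_left_mono up) simp
    also have "\<dots> = (norm w)\<^sup>2 - (norm (B w))\<^sup>2 / M\<^sup>2" using M(1) by (simp add: power2_eq_square field_simps)
    also have "\<dots> \<le> (norm w)\<^sup>2 - (norm w)\<^sup>2 / C\<^sup>2 / M\<^sup>2"
      by (intro diff_left_mono divide_right_mono low) simp
    also have "\<dots> = (q * norm w)\<^sup>2" by (simp add: power_mult_distrib q(3) left_diff_distrib)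
    finally show "(norm (F w))\<^sup>2 \<le> (q * norm w)\<^sup>2" .
  qed (use q in simp)
  have K_A: "A y \<in> K" if y: "y \<in> K" for y
  proof -
    let ?z = "A y"
    have Qy: "Q y = y" using y by (simp add: K_def)
    have Qz: "Q ?z = ?z" by (simp add: QA Qy)
    have Qn: "Q ((F ^^ n) ?z) = (F ^^ n) ?z" for n by (induction n) (simp_all add: Qz QF)
    have diff: "?z - (F ^^ n) ?z \<in> K" for n
    proof (induction n)
      case 0
      then show ?case using K_scale[OF y, of 0] by simp
    next
      case (Suc n)
      let ?d = "?z - (F ^^ n) ?z"
      have BB: "B (B ?z) \<in> K" using K_B[OF y] by (simp add: BA Qy)
      have eq: "?z - (F ^^ Suc n) ?z = (1 / M\<^sup>2) *\<^sub>R B (B ?z) + (?d + (- 1 / M\<^sup>2) *\<^sub>R B (B ?d))"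
        by (simp add: F_def lB algebra_simps)
      show ?case
        unfolding eq by (rule K_add[OF K_scale[OF BB] K_add[OF Suc K_scale[OF K_B[OF K_B[OF Suc]]]]])
    qed
    have "norm ((F ^^ n) ?z) \<le> q ^ n * norm ?z" for n
    proof (induction n)
      case (Suc n)
      have "norm ((F ^^ Suc n) ?z) \<le> q * norm ((F ^^ n) ?z)" using F_norm[OF Qn] by simp
      also have "\<dots> \<le> q * (q ^ n * norm ?z)" by (intro mult_left_mono Suc q)
      finally show ?case by (simp add: mult.assoc)
    qed simp
    moreover have "(\<lambda>n. q ^ n * norm ?z) \<longlonglongrightarrow> 0"
      using tendsto_mult_left_zero[OF LIMSEQ_realpow_zero[OF q(1,2)]] .
    ultimately have F0: "(\<lambda>n. (F ^^ n) ?z) \<longlonglongrightarrow> 0"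
      by (intro Lim_null_comparison[of "\<lambda>n. (F ^^ n) ?z"]) auto
    have "cinner ((B ^^ k) ?z) \<phi> = 0" for k
    proof -
      have bl: "bounded_linear (\<lambda>w. cinner ((B ^^ k) w) \<phi>)"
        by (rule bounded_linear_compose[OF bounded_linear_cinner_left
              bounded_clinearD(1)[OF selfadjointD(1)[OF selfadjoint_funpow[OF B]]]])
      have "cinner ((B ^^ k) (?z - (F ^^ n) ?z)) \<phi> = 0" for n using diff[of n] unfolding K_def by blast
      then have "cinner ((B ^^ k) ((F ^^ n) ?z)) \<phi> = cinner ((B ^^ k) ?z) \<phi>" for n
        by (simp add: lBn cinner_diff_left)
      then show ?thesis
        using bounded_linear.tendsto[OF bl F0] by (simp add: lBn LIMSEQ_const_iff)
    qed
    then show ?thesis by (simp add: K_def Qz)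
  qed
  have K_T: "T y \<in> K" if y: "y \<in> K" for y
  proof -
    have "cinner ((B ^^ 0) y) \<phi> = 0" using y unfolding K_def by blast
    then have "T y = A y + s *\<^sub>R y" by (simp add: A_def)
    then show ?thesis using K_add[OF K_A[OF y] K_scale[OF y]] by simp
  qed
  have "B x \<in> K" using zero by (simp add: K_def QB funpow_swap1)
  then have "(T ^^ n) (B x) \<in> K" for n by (induction n) (simp_all add: K_T)
  then have "cinner ((B ^^ 0) ((T ^^ n) (B x))) \<phi> = 0" for n unfolding K_def by blast
  then have "B x = 0" by (intro cyclic_powers) simp
  then show "x = 0" using AB[of x] x lA by simp
qed

lemma common_range_trivial:
  fixes P Q :: "'a \<Rightarrow> 'a"
  assumes T': "selfadjoint (\<lambda>y. T y + cinner y \<phi> *\<^sub>C \<phi>)"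
    and P: "orth_projection P" "\<And>y. P (T y) = T (P y)"
    and Q: "orth_projection Q" "\<And>y. Q (T y + cinner y \<phi> *\<^sub>C \<phi>) = T (Q y) + cinner (Q y) \<phi> *\<^sub>C \<phi>"
    and d: "d > 0" and belowP: "\<And>y. P y = y \<Longrightarrow> d * norm y \<le> norm (T y - s *\<^sub>R y)"
    and belowQ: "\<And>y. Q y = y \<Longrightarrow> d * norm y \<le> norm (T y + cinner y \<phi> *\<^sub>C \<phi> - s *\<^sub>R y)"
    and s: "s \<in> ess_spectrum T" and x: "P x = x" "Q x = x"
  shows "x = 0"
proof (rule ccontr)
  assume "x \<noteq> 0"
  define T' where "T' y = T y + cinner y \<phi> *\<^sub>C \<phi>" for y
  have sT': "selfadjoint T'" unfolding T'_def by (rule T')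
  have T'T: "T' y = T y + cinner y \<phi> *\<^sub>C \<phi>" for y by (simp add: T'_def)
  note lP = selfadjoint_simps[OF orth_projectionD(1)[OF P(1)]] and lQ = selfadjoint_simps[OF orth_projectionD(1)[OF Q(1)]]
  have QA: "Q (T' y - t *\<^sub>R y) = T' (Q y) - t *\<^sub>R Q y" for y t
    by (simp only: lQ(2,6) Q(2) T'T)
  have PA: "P (T y - t *\<^sub>R y) = T (P y) - t *\<^sub>R P y" for y t by (simp add: lP P(2))
  have below: "d/2 * norm y \<le> norm (N y - t *\<^sub>R y)"
    if "d * norm y \<le> norm (N y - s *\<^sub>R y)" "\<bar>t - s\<bar> \<le> d/2" for N :: "'a \<Rightarrow> 'a" and t y
  proof -
    have "N y - s *\<^sub>R y = (N y - t *\<^sub>R y) + (t - s) *\<^sub>R y" by (simp add: algebra_simps)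
    then have "norm (N y - s *\<^sub>R y) \<le> norm (N y - t *\<^sub>R y) + \<bar>t - s\<bar> * norm y"
      by (metis norm_triangle_ineq norm_scaleR)
    moreover have "\<bar>t - s\<bar> * norm y \<le> d/2 * norm y" using that(2) by (intro mult_right_mono) auto
    ultimately show ?thesis using that(1) by simp
  qed
  have belowQ': "d * norm y \<le> norm (T' y - s *\<^sub>R y)" if "Q y = y" for y
    using belowQ[OF that] by (simp only: T'T)
  obtain B where B: "selfadjoint B" "\<And>x. Q (B x) = B x" and "\<And>x. B (Q x) = B x" and B': "\<And>x. T' (B x) - s *\<^sub>R B x = Q x"
      "\<And>x. B (T' x - s *\<^sub>R x) = Q x" "\<And>x. norm (B x) \<le> norm x / d"
  proof (rule reduced_inverse[where A = "\<lambda>y. T' y - s *\<^sub>R y" and P = Q and d = d])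
    show "selfadjoint (\<lambda>y. T' y - s *\<^sub>R y)" by (rule selfadjoint_shift[OF sT'])
    show "orth_projection Q" by (rule Q(1))
    show "Q (T' y - s *\<^sub>R y) = T' (Q y) - s *\<^sub>R Q y" for y by (rule QA)
    show "d > 0" by (rule d)
    show "d * norm y \<le> norm (T' y - s *\<^sub>R y)" if "Q y = y" for y using that by (rule belowQ')
  qed (rule that)
  have "\<exists>n. cinner ((B ^^ Suc n) x) \<phi> \<noteq> 0"
  proof (rule ccontr)
    assume "\<not> ?thesis"
    then have "x = 0"
      by (intro reduced_resolvent_moments_zero[OF T' Q(1) B(1,2) B'(1,2)[unfolded T'T] QA[unfolded T'T] x(2)]) auto
    then show False using \<open>x \<noteq> 0\<close> by contradiction
  qed
  then obtain N where N: "cinner ((B ^^ Suc N) x) \<phi> \<noteq> 0" "\<And>n. n < N \<Longrightarrow> cinner ((B ^^ Suc n) x) \<phi> = 0"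
    using exists_least_iff[of "\<lambda>n. cinner ((B ^^ Suc n) x) \<phi> \<noteq> 0"] by blast
  define \<alpha> where "\<alpha> = cinner ((B ^^ Suc N) x) \<phi>"
  define L where "L = norm x / (d/2)"
  define G where "G = (1 / d) ^ Suc N * L * norm \<phi>"
  have L: "L > 0" using d \<open>x \<noteq> 0\<close> by (simp add: L_def)
  have G: "G \<ge> 0" using d L by (simp add: G_def)
  define r where "r = min (d/2) (cmod \<alpha> / 2 / (G + 1))"
  have "r \<le> d/2" unfolding r_def by (rule min.cobounded1)
  moreover have "r > 0" using d N(1) G by (simp add: r_def \<alpha>_def add_nonneg_pos)
  ultimately have r: "r > 0" "r \<le> d/2" by blast+
  have rG: "r * G \<le> cmod \<alpha> / 2"
  proof -
    have "r * G \<le> cmod \<alpha> / 2 / (G + 1) * (G + 1)" using G r by (intro mult_mono) (auto simp: r_def)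
    also have "\<dots> = cmod \<alpha> / 2" using G by (simp add: field_simps)
    finally show ?thesis .
  qed
  have B_pow: "norm ((B ^^ n) y) \<le> (1 / d) ^ n * norm y" for n y
  proof (induction n)
    case (Suc n)
    have "norm ((B ^^ Suc n) y) \<le> 1 / d * norm ((B ^^ n) y)" using B'(3)[of "(B ^^ n) y"] by simp
    also have "\<dots> \<le> 1 / d * ((1 / d) ^ n * norm y)" using d by (intro mult_left_mono Suc) auto
    finally show ?case by (simp only: power_Suc mult.assoc)
  qed simp
  have resolvents: "\<exists>w. T w - t *\<^sub>R w = \<phi> \<and> norm w \<le> 2 * L / (\<bar>t - s\<bar> ^ N * (cmod \<alpha> / 2))"
    if t: "\<bar>t - s\<bar> < r" "t \<noteq> s" for t
  proof -
    have td: "\<bar>t - s\<bar> \<le> d/2" and d2: "d/2 > 0" using t r d by auto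
    have bP: "d/2 * norm y \<le> norm (T y - t *\<^sub>R y)" if "P y = y" for y
      by (rule below[of y T t, OF belowP[OF that] td])
    have bQ: "d/2 * norm y \<le> norm (T' y - t *\<^sub>R y)" if "Q y = y" for y
      by (rule below[of y T' t, OF belowQ'[OF that] td])
    obtain R where "selfadjoint R" and R: "\<And>x. P (R x) = R x" and "\<And>x. R (P x) = R x"
      and R': "\<And>x. T (R x) - t *\<^sub>R R x = P x" and "\<And>x. R (T x - t *\<^sub>R x) = P x"
      and R'': "\<And>x. norm (R x) \<le> norm x / (d/2)"
    proof (rule reduced_inverse[where A = "\<lambda>y. T y - t *\<^sub>R y" and P = P and d = "d/2"])
      show "selfadjoint (\<lambda>y. T y - t *\<^sub>R y)" by (rule selfadjoint_shift[OF selfadjoint])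
      show "orth_projection P" by (rule P(1))
      show "P (T y - t *\<^sub>R y) = T (P y) - t *\<^sub>R P y" for y by (rule PA)
      show "d/2 > 0" by (rule d2)
      show "d/2 * norm y \<le> norm (T y - t *\<^sub>R y)" if "P y = y" for y using that by (rule bP)
    qed (rule that)
    obtain S where "selfadjoint S" and S: "\<And>x. Q (S x) = S x" and "\<And>x. S (Q x) = S x"
      and S': "\<And>x. T' (S x) - t *\<^sub>R S x = Q x" and "\<And>x. S (T' x - t *\<^sub>R x) = Q x"
      and S'': "\<And>x. norm (S x) \<le> norm x / (d/2)"
    proof (rule reduced_inverse[where A = "\<lambda>y. T' y - t *\<^sub>R y" and P = Q and d = "d/2"])
      show "selfadjoint (\<lambda>y. T' y - t *\<^sub>R y)" by (rule selfadjoint_shift[OF sT'])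
      show "orth_projection Q" by (rule Q(1))
      show "Q (T' y - t *\<^sub>R y) = T' (Q y) - t *\<^sub>R Q y" for y by (rule QA)
      show "d/2 > 0" by (rule d2)
      show "d/2 * norm y \<le> norm (T' y - t *\<^sub>R y)" if "Q y = y" for y using that by (rule bQ)
    qed (rule that)
    define u where "u = R x"
    define v where "v = S x"
    define h where "h = t - s"
    have u: "T u - t *\<^sub>R u = x" "norm u \<le> L" using R R' R''[of x] x by (simp_all add: u_def L_def)
    have v: "Q v = v" "T' v - t *\<^sub>R v = x" "norm v \<le> L" using S S' S''[of x] x by (simp_all add: v_def L_def)
    have "v = B (T' v - s *\<^sub>R v)" using B'(2)[of v] v(1) by simp
    also have "T' v - s *\<^sub>R v = x + h *\<^sub>R v" using v(2) by (simp add: h_def algebra_simps)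
    finally have vB: "v = B x + h *\<^sub>R B v" by (simp add: selfadjoint_simps[OF B(1)])
    have expand: "cinner v \<phi> = (\<Sum>j<m. complex_of_real (h ^ j) * cinner ((B ^^ Suc j) x) \<phi>)
        + complex_of_real (h ^ m) * cinner ((B ^^ m) v) \<phi>" for m
    proof (induction m)
      case (Suc m)
      have "(B ^^ m) v = (B ^^ m) (B x) + h *\<^sub>R (B ^^ m) (B v)"
        by (subst vB) (simp add: selfadjoint_simps[OF selfadjoint_funpow[OF B(1)]])
      then have "cinner ((B ^^ m) v) \<phi> = cinner ((B ^^ Suc m) x) \<phi> + complex_of_real h * cinner ((B ^^ Suc m) v) \<phi>"
        by (simp only: cinner_add_left cinner_scaleR_left funpow_Suc_right o_apply)
      then show ?case using Suc by (simp add: algebra_simps)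
    qed simp
    have "cinner v \<phi> = complex_of_real (h ^ N) * (\<alpha> + complex_of_real h * cinner ((B ^^ Suc N) v) \<phi>)"
      using expand[of "Suc N"] N(2) by (simp add: \<alpha>_def algebra_simps)
    then have "cmod (cinner v \<phi>) = \<bar>h\<bar> ^ N * cmod (\<alpha> + complex_of_real h * cinner ((B ^^ Suc N) v) \<phi>)"
      by (simp add: norm_mult power_abs norm_power)
    moreover have "cmod (\<alpha> + complex_of_real h * cinner ((B ^^ Suc N) v) \<phi>) \<ge> cmod \<alpha> / 2"
    proof -
      have "cmod (cinner ((B ^^ Suc N) v) \<phi>) \<le> norm ((B ^^ Suc N) v) * norm \<phi>" by (rule cmod_cinner_le)
      also have "\<dots> \<le> (1 / d) ^ Suc N * norm v * norm \<phi>" by (intro mult_right_mono B_pow) simp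
      also have "\<dots> \<le> G" unfolding G_def using d v(3) by (intro mult_right_mono mult_left_mono) auto
      finally have "\<bar>h\<bar> * cmod (cinner ((B ^^ Suc N) v) \<phi>) \<le> r * G"
        using t(1) r(1) by (intro mult_mono) (auto simp: h_def)
      then have "cmod (complex_of_real h * cinner ((B ^^ Suc N) v) \<phi>) \<le> cmod \<alpha> / 2"
        using rG by (simp add: norm_mult)
      then show ?thesis
        using norm_diff_ineq[of \<alpha> "complex_of_real h * cinner ((B ^^ Suc N) v) \<phi>"] by linarith
    qed
    ultimately have a: "cmod (cinner v \<phi>) \<ge> \<bar>h\<bar> ^ N * (cmod \<alpha> / 2)"
      by (metis mult_left_mono zero_le_power abs_ge_zero)
    have pos: "\<bar>h\<bar> ^ N * (cmod \<alpha> / 2) > 0" using t(2) N(1) by (simp add: h_def \<alpha>_def)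
    have a0: "cinner v \<phi> \<noteq> 0" using a pos by auto
    define w where "w = (1 / cinner v \<phi>) *\<^sub>C (u - v)"
    have "T (u - v) - t *\<^sub>R (u - v) = cinner v \<phi> *\<^sub>C \<phi>"
      using u(1) v(2) by (simp add: T'T lin_T algebra_simps)
    then have "(1 / cinner v \<phi>) *\<^sub>C (T (u - v) - t *\<^sub>R (u - v)) = \<phi>"
      using a0 by (simp add: scaleC_scaleC scaleC_one)
    then have "T w - t *\<^sub>R w = \<phi>"
      unfolding w_def by (simp only: lin_T(5) scaleC_diff_right[of _ "T (u - v)"] scaleC_scaleR)
    moreover have "norm w \<le> 2 * L / (\<bar>h\<bar> ^ N * (cmod \<alpha> / 2))"
    proof -
      have "norm w = norm (u - v) / cmod (cinner v \<phi>)" by (simp add: w_def norm_scaleC norm_divide)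
      also have "\<dots> \<le> 2 * L / (\<bar>h\<bar> ^ N * (cmod \<alpha> / 2))"
        using L u(2) v(3) norm_triangle_ineq4[of u v] a pos by (intro frac_le) auto
      finally show ?thesis .
    qed
    ultimately show ?thesis unfolding h_def by blast
  qed
  have "s \<notin> ess_spectrum T"
  proof (rule not_in_ess_spectrum_isolated[OF r(1) _ finite_range_singleton])
    fix y
    show "E ({s - r<..<s + r} - {s}) y = 0"
    proof (rule E_null_local)
      fix t assume "t \<in> {s - r<..<s + r} - {s}"
      then have t: "\<bar>t - s\<bar> < r" "t \<noteq> s" by auto
      define e where "e = min (\<bar>t - s\<bar> / 2) ((r - \<bar>t - s\<bar>) / 2)"
      have "e > 0" using t by (simp add: e_def)
      moreover have "e \<le> \<bar>t - s\<bar> / 2" "e \<le> (r - \<bar>t - s\<bar>) / 2"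
        unfolding e_def by (rule min.cobounded1, rule min.cobounded2)
      ultimately have e: "e > 0" "e \<le> \<bar>t - s\<bar> / 2" "e \<le> (r - \<bar>t - s\<bar>) / 2" by blast+
      have "E {t - e<..t + e} \<phi> = 0"
      proof (rule E_null_bounded_preimages[where k = "2 * L / ((\<bar>t - s\<bar> / 2) ^ N * (cmod \<alpha> / 2))"])
        fix t' assume t': "t' \<in> {t - e..t + e}"
        have c: "\<bar>t' - s\<bar> < r" "\<bar>t - s\<bar> / 2 \<le> \<bar>t' - s\<bar>" "t' \<noteq> s" using t' t e by (auto simp: abs_if split: if_splits)
        obtain w where w: "T w - t' *\<^sub>R w = \<phi>" "norm w \<le> 2 * L / (\<bar>t' - s\<bar> ^ N * (cmod \<alpha> / 2))"
          using resolvents[OF c(1,3)] by blast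
        have "2 * L / (\<bar>t' - s\<bar> ^ N * (cmod \<alpha> / 2)) \<le> 2 * L / ((\<bar>t - s\<bar> / 2) ^ N * (cmod \<alpha> / 2))"
          using L t(2) c(2) N(1) by (intro divide_left_mono mult_right_mono power_mono mult_pos_pos) (auto simp: \<alpha>_def c(3))
        then show "\<exists>w. T w - t' *\<^sub>R w = \<phi> \<and> norm w \<le> 2 * L / ((\<bar>t - s\<bar> / 2) ^ N * (cmod \<alpha> / 2))"
          using w by (intro exI[of _ w]) simp
      qed (use e in simp)
      then have "E {t - e<..<t + e} \<phi> = 0" by (rule E_null_mono[rotated 3]) auto
      then have "E {t - e<..<t + e} y = 0" by (rule E_null_cyclic[rotated]) simp
      then show "\<exists>e>0. E {t - e<..<t + e} y = 0" using e(1) by blast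
    qed simp
  qed
  then show False using s by contradiction
qed

end

lemma cyclic_vector_orthogonal:
  assumes "cyclic_vector T \<phi>" and orth: "\<And>A. A \<in> sets borel \<Longrightarrow> cinner y (spectral_projection T A \<phi>) = 0"
  shows "y = 0"
proof -
  let ?S = "(\<lambda>A. spectral_projection T A \<phi>) ` sets borel"
  let ?W = "{w. cinner w y = 0}"
  have "complex_vector.subspace ?W"
    by (auto simp: complex_vector.subspace_def cinner_add_left cinner_scaleC_left)
  moreover have "?S \<subseteq> ?W" using orth cinner_0_iff by blast
  ultimately have "cspan ?S \<subseteq> ?W" by (rule complex_vector.span_minimal[rotated])
  moreover have "closed ?W"
    by (intro closed_Collect_eq linear_continuous_on bounded_linear_cinner_left continuous_on_const)
  ultimately have "closure (cspan ?S) \<subseteq> ?W" by (rule closure_minimal)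
  then have "cinner y y = 0" using assms(1) unfolding cyclic_vector_def by blast
  then show ?thesis by (simp add: cinner_self)
qed

lemma subspace_range_projection:
  assumes "orth_projection P" shows "complex_vector.subspace (range P)"
proof -
  have "range P = {x. P x = x}"
    using orth_projectionD(2)[OF assms] by (auto intro: range_eqI[OF sym])
  then show ?thesis
    by (auto simp: complex_vector.subspace_def selfadjoint_simps[OF orth_projectionD(1)[OF assms]])
qed

lemma subspace_kernel:
  assumes "bounded_clinear G" shows "complex_vector.subspace {x. G x = 0}"
  by (auto simp: complex_vector.subspace_def bounded_clinearD[OF assms])

lemma finite_cdim_perturbed_range:
  fixes P Q S :: "'a::complex_inner \<Rightarrow> 'a"
  assumes P: "orth_projection P" and Q: "orth_projection Q" and S: "bounded_clinear S"
    and fP: "\<not> infinite_cdim (range P)" and fS: "\<not> infinite_cdim (range S)"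
    and triv: "\<And>y. Q y = y \<Longrightarrow> P y = 0 \<Longrightarrow> S y = 0 \<Longrightarrow> y = 0"
  shows "\<not> infinite_cdim (range Q)"
proof (rule finite_cdim_extension[OF subspace_range_projection[OF Q] selfadjointD(1)[OF orth_projectionD(1)[OF P]] fP])
  let ?V = "{x \<in> range Q. P x = 0}"
  have "complex_vector.subspace ?V"
    using complex_vector.subspace_inter[OF subspace_range_projection[OF Q] subspace_kernel[OF selfadjointD(1)[OF orth_projectionD(1)[OF P]]]]
    by (simp add: Int_def)
  then show "\<not> infinite_cdim ?V"
  proof (rule finite_cdim_extension[OF _ S fS])
    have "{x \<in> ?V. S x = 0} \<subseteq> {0}" using triv orth_projectionD(2)[OF Q] by auto
    then show "\<not> infinite_cdim {x \<in> ?V. S x = 0}" using infinite_cdim_mono not_infinite_cdim_zero by blast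
  qed
qed

lemma infinite_cdim_common_kernel:
  fixes P Q :: "'a::complex_inner \<Rightarrow> 'a"
  assumes P: "orth_projection P" and Q: "orth_projection Q"
    and fP: "\<not> infinite_cdim (range P)" and fQ: "\<not> infinite_cdim (range Q)"
    and inf: "infinite_cdim (UNIV :: 'a set)" and sub: "\<And>y. P y = 0 \<Longrightarrow> Q y = 0 \<Longrightarrow> y \<in> K"
  shows "infinite_cdim K"
proof (rule ccontr)
  assume K: "\<not> infinite_cdim K"
  have "{x \<in> {x. P x = 0}. Q x = 0} \<subseteq> K" using sub by auto
  then have "\<not> infinite_cdim {x \<in> {x. P x = 0}. Q x = 0}" using K infinite_cdim_mono by blast
  then have "\<not> infinite_cdim {x. P x = 0}"
    by (rule finite_cdim_extension[OF subspace_kernel[OF selfadjointD(1)[OF orth_projectionD(1)[OF P]]]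
          selfadjointD(1)[OF orth_projectionD(1)[OF Q]] fQ])
  then have "\<not> infinite_cdim (UNIV :: 'a set)"
    by (intro finite_cdim_extension[OF complex_vector.subspace_UNIV selfadjointD(1)[OF orth_projectionD(1)[OF P]] fP]) simp
  then show False using inf by contradiction
qed

theorem theorem4p3:
  fixes T S :: "'a::complex_hilbert_space \<Rightarrow> 'a"
    and \<phi> :: 'a
    and D :: "real \<Rightarrow> 'a \<Rightarrow> 'a"
    and l :: real
  assumes separable: "separable_space (euclidean :: 'a topology)"
    and infinite_dim: "infinite_cdim (UNIV :: 'a set)"
    and T: "selfadjoint T"
    and S: "S = (\<lambda>x. cinner x \<phi> *\<^sub>C \<phi>)" "selfadjoint S"
    and rank_one: "cdim (range S) = 1"
    and cyclic: "cyclic_vector T \<phi>"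
    and D: "\<And>r x. D r x = spectral_projection (\<lambda>y. T y + S y) {..<r} x
                        - spectral_projection T {..<r} x"
    and l: "l \<notin> {min_ess T, max_ess T}"
  shows "(infinite_cdim (op_kernel (D l)) \<longleftrightarrow> l \<notin> {min_ess T..max_ess T}) \<and>
         (op_kernel (D l) = {0} \<longleftrightarrow> l \<in> {min_ess T<..<max_ess T}) \<and>
         (op_kernel (D l) = {0} \<or> infinite_cdim (op_kernel (D l)))"
proof -
  define T' where "T' y = T y + S y" for y
  have T'_eq: "T' y = T y + cinner y \<phi> *\<^sub>C \<phi>" for y by (simp add: T'_def S(1))
  have sT': "selfadjoint T'" unfolding T'_def by (rule selfadjoint_add[OF T S(2)])
  define E where "E = spectral_projection T"
  define E' where "E' = spectral_projection T'"
  interpret E: cyclic_spectral_measure E T \<phi>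
  proof unfold_locales
    show "selfadjoint T" by (rule T)
    show "is_spectral_measure E T" unfolding E_def by (rule spectral_projection_is_spectral_measure[OF T])
    show "y = 0" if "\<And>A. A \<in> sets borel \<Longrightarrow> cinner y (E A \<phi>) = 0" for y
      by (rule cyclic_vector_orthogonal[OF cyclic]) (use that in \<open>simp add: E_def\<close>)
  qed
  interpret E': spectral_measure E' T'
    unfolding E'_def using sT' spectral_projection_is_spectral_measure[OF sT'] by unfold_locales
  have "(\<lambda>y. T y + S y) = T'" by (rule ext) (simp add: T'_def)
  then have Dl: "D l x = E' {..<l} x - E {..<l} x" for x by (simp add: D E_def E'_def)
  have fS: "\<not> infinite_cdim (range S)"
  proof -
    have "range S \<subseteq> cspan {\<phi>}"
      unfolding S(1) by (intro image_subsetI complex_vector.span_scale complex_vector.span_base) simp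
    then show ?thesis unfolding infinite_cdim_def by blast
  qed
  have T'T: "T' y = T y" if "S y = 0" for y using that by (simp add: T'_def)
  have compl: "E {..<r} x = x - E {r..} x" "E' {..<r} x = x - E' {r..} x" for r x
    using E.E_compl[of "{r..}" x] E'.E_compl[of "{r..}" x] by (simp_all add: Compl_atLeast)
  have sep: "z = 0" if "inner (T z) z \<le> a * (norm z)\<^sup>2" "b * (norm z)\<^sup>2 \<le> inner (T z) z" "a < b" for a b z
  proof -
    have "0 \<le> (a - b) * (norm z)\<^sup>2" using that by (simp add: left_diff_distrib)
    then show ?thesis using that(3) by (auto simp: zero_le_mult_iff)
  qed
  have above: "infinite_cdim (op_kernel (D l))" if less: "max_ess T < l"
  proof -
    obtain r where r: "max_ess T < r" "r < l" using dense[OF less] by blast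
    have fr: "\<not> infinite_cdim (range (E {r..}))"
      using E.max_ess(2)[OF infinite_dim] r(1) by (intro E.finite_range_atLeast) force
    have fl: "\<not> infinite_cdim (range (E {l..}))"
      using infinite_cdim_mono[OF _ E.range_E_mono[of "{l..}" "{r..}"]] fr r(2) by auto
    have fl': "\<not> infinite_cdim (range (E' {l..}))"
    proof (rule finite_cdim_perturbed_range[OF E.proj E'.proj selfadjointD(1)[OF S(2)] fr fS])
      fix y assume y: "E' {l..} y = y" "E {r..} y = 0" "S y = 0"
      have "E {..<r} y = y" using compl(1)[of r y] y(2) by simp
      then have "inner (T y) y \<le> r * (norm y)\<^sup>2" by (intro E.form_le[of "{..<r}"]) auto
      moreover have "l * (norm y)\<^sup>2 \<le> inner (T y) y"
        using E'.form_ge[of "{l..}" l y] y(1) T'T[OF y(3)] by simp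
      ultimately show "y = 0" using sep r(2) by blast
    qed auto
    show ?thesis
      by (rule infinite_cdim_common_kernel[OF E.proj E'.proj fl fl' infinite_dim])
        (auto simp: op_kernel_def Dl compl)
  qed
  have below: "infinite_cdim (op_kernel (D l))" if less: "l < min_ess T"
  proof -
    obtain r where r: "l < r" "r < min_ess T" using dense[OF less] by blast
    have fr: "\<not> infinite_cdim (range (E {..r}))"
      using E.min_ess(2)[OF infinite_dim] r(2) by (intro E.finite_range_atMost) force
    have fl: "\<not> infinite_cdim (range (E {..<l}))"
    proof -
      have "{..<l} \<subseteq> {..r}" using r(1) by (intro subsetI) auto
      then show ?thesis using infinite_cdim_mono[OF _ E.range_E_mono[of "{..<l}" "{..r}"]] fr by auto
    qed
    have fl': "\<not> infinite_cdim (range (E' {..<l}))"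
    proof (rule finite_cdim_perturbed_range[OF E.proj E'.proj selfadjointD(1)[OF S(2)] fr fS])
      fix y assume y: "E' {..<l} y = y" "E {..r} y = 0" "S y = 0"
      have "E {r<..} y = y" using E.E_compl[of "{..r}" y] y(2) by (simp add: Compl_atMost)
      then have "r * (norm y)\<^sup>2 \<le> inner (T y) y" by (intro E.form_ge[of "{r<..}"]) auto
      moreover have "inner (T y) y \<le> l * (norm y)\<^sup>2"
        using E'.form_le[of "{..<l}" l y] y(1) T'T[OF y(3)] by (simp add: lessThan_subset_iff subset_iff less_imp_le)
      ultimately show "y = 0" using sep r(1) by blast
    qed auto
    show ?thesis
      by (rule infinite_cdim_common_kernel[OF E.proj E'.proj fl fl' infinite_dim])
        (auto simp: op_kernel_def Dl)
  qed
  have trivial: "x = 0"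
    if A: "A \<in> sets borel" and x: "E A x = x" "E' A x = x" and s: "s \<in> ess_spectrum T" and d: "d > 0"
      and disj: "A \<inter> {s - d<..<s + d} = {}" for A x s d
  proof (rule E.common_range_trivial[OF sT'[unfolded T'_eq[abs_def]] E.proj[OF A] E.E_commute[OF A] E'.proj[OF A] _ d _ _ s x])
    show "E' A (T y + cinner y \<phi> *\<^sub>C \<phi>) = T (E' A y) + cinner (E' A y) \<phi> *\<^sub>C \<phi>" for y
      using E'.E_commute[OF A, of y] by (simp only: T'_eq)
    show "d * norm y \<le> norm (T y - s *\<^sub>R y)" if "E A y = y" for y
      using E.norm_shift_ge[OF A disj that] d by simp
    show "d * norm y \<le> norm (T y + cinner y \<phi> *\<^sub>C \<phi> - s *\<^sub>R y)" if "E' A y = y" for y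
      using E'.norm_shift_ge[OF A disj that] d by (simp add: T'_eq)
  qed
  have inside: "op_kernel (D l) = {0}" if less: "min_ess T < l" "l < max_ess T"
  proof -
    have "y = 0" if "D l y = 0" for y
    proof -
      have eq: "E' {..<l} y = E {..<l} y" using that by (simp add: Dl)
      have "E {..<l} y = 0"
      proof (rule trivial[OF _ _ _ E.max_ess(1)[OF infinite_dim], of "{..<l}" _ "max_ess T - l"])
        show "E' {..<l} (E {..<l} y) = E {..<l} y"
          by (simp add: eq[symmetric] orth_projectionD(2)[OF E'.proj])
      qed (use less in \<open>auto simp: orth_projectionD(2)[OF E.proj]\<close>)
      moreover have "E {l..} y = 0"
      proof (rule trivial[OF _ _ _ E.min_ess(1)[OF infinite_dim], of "{l..}" _ "l - min_ess T"])
        have "E' {l..} y = E {l..} y" using eq by (simp add: compl)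
        then show "E' {l..} (E {l..} y) = E {l..} y"
          by (metis orth_projectionD(2)[OF E'.proj] atLeast_borel)
      qed (use less in \<open>auto simp: orth_projectionD(2)[OF E.proj]\<close>)
      ultimately show "y = 0" using compl(1)[of l y] by simp
    qed
    moreover have "D l 0 = 0" by (simp add: Dl E.lin_E E'.lin_E)
    ultimately show ?thesis by (auto simp: op_kernel_def)
  qed
  have "min_ess T \<le> max_ess T" using E.min_ess[OF infinite_dim] E.max_ess[OF infinite_dim] by blast
  then consider "l < min_ess T \<or> max_ess T < l" | "min_ess T < l" "l < max_ess T" using l by fastforce
  then show ?thesis
  proof cases
    case 1
    then have inf: "infinite_cdim (op_kernel (D l))" using above below by blast
    then have "op_kernel (D l) \<noteq> {0}" using not_infinite_cdim_zero by metis
    then show ?thesis using inf 1 by auto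
  next
    case 2
    then have ker: "op_kernel (D l) = {0}" by (rule inside)
    show ?thesis unfolding ker using not_infinite_cdim_zero 2 by auto
  qed
qed

end
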